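(* Let $\mathbb{F}$ be a field, let $X$ and $Y$ be $n\times n$ matrices of variables, and let $r\le n$. Let $\omega\in\mathbb{F}$ have multiplicative order at least $n$, let $S\subseteq\mathbb{F}\setminus\{0\}$ with $|S|=2r(n-r)+1$, and let $\mathcal{E}=\{W_\omega(\alpha):\alpha\in S\}\subseteq\mathbb{F}^{r\times n}$, where $(W_\omega(\alpha))_{i,j}=(\omega^i\alpha)^j$. Let $t:\mathbb{N}\to\mathbb{N}$ be a function such that: if $\mathrm{char}(\mathbb{F})=0$, any formula computing $\det_n(X)+O(\varepsilon)$ has size at least $t(n)$; and if $\mathrm{char}(\mathbb{F})=p>0$, any formula computing $\det_n(X)^{p^k}+O(\varepsilon)$ for any $k\in\mathbb{N}$ has size at least $t(n)$. Let $C(X,Y,\vec z,W,U,V)$ be an IPS refutation of the system \[ \det_r(EXE^\top)=0\ \ (\forall E\in\mathcal{E}),\quad XY-I_n=0,\quad X\odot X-X=0,\quad Y\odot Y-Y=0, \] where $\vec z$ are placeholder variables for the first set of equations and $W,U,V$ are $n\times n$ matrices of placeholder variables for the second, third, and fourth sets. Then any formula computing $C(X,Y,\vec z,W,U,V)+O(\varepsilon)$ must have size $\Omega\big(t(\Omega(r^{1/3}))/n^3\big)$.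
   Context: $I_n$ is the identity matrix and $\odot$ the entrywise product. An IPS refutation of a system $f_1=\dots=f_k=0$ of polynomials in $\vec x$ is a polynomial $C(\vec x,y_1,\dots,y_k)$ with $C(\vec x,\vec 0)=0$ and $C(\vec x,f_1(\vec x),\dots,f_k(\vec x))=1$. $\varepsilon$ is an indeterminate; a formula computing $f+O(\varepsilon)$ is an algebraic formula with constants from $\mathbb{F}((\varepsilon))$ computing $f+\varepsilon g$ with $g\in\mathbb{F}[[\varepsilon]][\text{variables}]$. *)

theory Defs
  imports
    "HOL-Library.Poly_Mapping"
    "HOL-Library.Extended_Nat"
    "HOL-Library.Landau_Symbols"
    "HOL-Computational_Algebra.Formal_Laurent_Series"
    "Jordan_Normal_Form.Determinant"
begin

text \<open>A polynomial with coefficients in 'a maps each exponent vector to its coefficient; the ring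
  structure is the convolution structure of \<^theory>\<open>HOL-Library.Poly_Mapping\<close>.\<close>

type_synonym ('v, 'a) mpoly = "('v \<Rightarrow>\<^sub>0 nat) \<Rightarrow>\<^sub>0 'a"

definition mconst :: "'a \<Rightarrow> ('v, 'a::zero) mpoly" where
  "mconst c = Poly_Mapping.single 0 c"

definition mvar :: "'v \<Rightarrow> ('v, 'a::zero_neq_one) mpoly" where
  "mvar v = Poly_Mapping.single (Poly_Mapping.single v 1) 1"

definition mvars :: "('v, 'a::zero) mpoly \<Rightarrow> 'v set" where
  "mvars p = (\<Union>m\<in>Poly_Mapping.keys p. Poly_Mapping.keys m)"

definition msubst :: "('v \<Rightarrow> ('w, 'a) mpoly) \<Rightarrow> ('v, 'a) mpoly \<Rightarrow> ('w, 'a::comm_ring_1) mpoly" where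
  "msubst \<sigma> p = (\<Sum>m\<in>Poly_Mapping.keys p.
     mconst (Poly_Mapping.lookup p m) *
     (\<Prod>v\<in>Poly_Mapping.keys m. \<sigma> v ^ Poly_Mapping.lookup m v))"

text \<open>Formulas have fan-in two and their size is the number of nodes, leaves included. Counting only the
  leaves, or allowing unbounded fan-in, changes sizes by constant factors only.\<close>

datatype ('v, 'c) formula =
    FVar 'v
  | FConst 'c
  | FAdd "('v, 'c) formula" "('v, 'c) formula"
  | FMul "('v, 'c) formula" "('v, 'c) formula"

primrec formula_size :: "('v, 'c) formula \<Rightarrow> nat" where
  "formula_size (FVar v) = 1"
| "formula_size (FConst c) = 1"
| "formula_size (FAdd \<Phi> \<Psi>) = formula_size \<Phi> + formula_size \<Psi> + 1"
| "formula_size (FMul \<Phi> \<Psi>) = formula_size \<Phi> + formula_size \<Psi> + 1"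

primrec formula_vars :: "('v, 'c) formula \<Rightarrow> 'v set" where
  "formula_vars (FVar v) = {v}"
| "formula_vars (FConst c) = {}"
| "formula_vars (FAdd \<Phi> \<Psi>) = formula_vars \<Phi> \<union> formula_vars \<Psi>"
| "formula_vars (FMul \<Phi> \<Psi>) = formula_vars \<Phi> \<union> formula_vars \<Psi>"

primrec formula_poly :: "('v, 'c::comm_ring_1) formula \<Rightarrow> ('v, 'c) mpoly" where
  "formula_poly (FVar v) = mvar v"
| "formula_poly (FConst c) = mconst c"
| "formula_poly (FAdd \<Phi> \<Psi>) = formula_poly \<Phi> + formula_poly \<Psi>"
| "formula_poly (FMul \<Phi> \<Psi>) = formula_poly \<Phi> * formula_poly \<Psi>"

text \<open>\<open>border_computes Vs \<Phi> f\<close>: the formula \<open>\<Phi>\<close> in the variables \<open>Vs\<close>, with constants that are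
  Laurent series in \<open>\<epsilon>\<close> (written \<^const>\<open>fls_X\<close>), computes \<open>f + O(\<epsilon>)\<close>.\<close>

definition border_computes ::
    "'v set \<Rightarrow> ('v, 'a fls) formula \<Rightarrow> ('v, 'a::comm_ring_1) mpoly \<Rightarrow> bool" where
  "border_computes Vs \<Phi> f \<longleftrightarrow> formula_vars \<Phi> \<subseteq> Vs \<and>
     (\<exists>g :: ('v, 'a fps) mpoly. mvars g \<subseteq> Vs \<and>
        formula_poly \<Phi> = Poly_Mapping.map fls_const f + mconst fls_X * Poly_Mapping.map fps_to_fls g)"

text \<open>The system is \<open>f i = 0\<close> for \<open>i \<in> I\<close>, over the variables \<open>Xs\<close>. In a refutation, \<open>Inl x\<close> is
  the variable \<open>x\<close> of the system and \<open>Inr i\<close> is the placeholder variable for \<open>f i\<close>.\<close>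

definition ips_refutation ::
    "'x set \<Rightarrow> 'i set \<Rightarrow> ('i \<Rightarrow> ('x, 'a) mpoly) \<Rightarrow> ('x + 'i, 'a::comm_ring_1) mpoly \<Rightarrow> bool" where
  "ips_refutation Xs I f C \<longleftrightarrow> mvars C \<subseteq> Inl ` Xs \<union> Inr ` I \<and>
     msubst (case_sum mvar (\<lambda>_. 0)) C = 0 \<and>
     msubst (case_sum mvar f) C = 1"

text \<open>The value \<open>\<infinity>\<close> means that no positive power of \<open>x\<close> is 1.\<close>

definition mult_order :: "'a::monoid_mult \<Rightarrow> enat" where
  "mult_order x = Inf (enat ` {k. 0 < k \<and> x ^ k = 1})"

text \<open>The entries \<open>(\<omega>^i \<alpha>)^j\<close> have \<open>1 \<le> i \<le> r\<close> and \<open>1 \<le> j \<le> n\<close>, whereas matrix indices start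
  at 0.\<close>

definition W_mat :: "nat \<Rightarrow> nat \<Rightarrow> 'a::field \<Rightarrow> 'a \<Rightarrow> 'a mat" where
  "W_mat r n \<omega> \<alpha> = mat r n (\<lambda>(i, j). (\<omega> ^ Suc i * \<alpha>) ^ Suc j)"

definition var_mat :: "nat \<Rightarrow> (nat \<Rightarrow> nat \<Rightarrow> 'v) \<Rightarrow> ('v, 'a::zero_neq_one) mpoly mat" where
  "var_mat n x = mat n n (\<lambda>(i, j). mvar (x i j))"

definition hadamard :: "'a::times mat \<Rightarrow> 'a mat \<Rightarrow> 'a mat" where
  "hadamard A B = mat (dim_row A) (dim_col A) (\<lambda>ij. A $$ ij * B $$ ij)"

datatype base_var = XVar nat nat | YVar nat nat

text \<open>The placeholders \<open>\<^bold>z\<close> are indexed by the matrices \<open>E\<close> of the set \<open>\<E>\<close>.\<close>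

datatype 'a placeholder = ZVar "'a mat" | WVar nat nat | UVar nat nat | VVar nat nat

definition base_vars :: "nat \<Rightarrow> base_var set" where
  "base_vars n = (\<Union>i<n. \<Union>j<n. {XVar i j, YVar i j})"

definition placeholders :: "nat \<Rightarrow> 'a mat set \<Rightarrow> 'a placeholder set" where
  "placeholders n \<E> = ZVar ` \<E> \<union> (\<Union>i<n. \<Union>j<n. {WVar i j, UVar i j, VVar i j})"

primrec rank_inverse_system ::
    "nat \<Rightarrow> 'a::field placeholder \<Rightarrow> (base_var, 'a) mpoly" where
  "rank_inverse_system n (ZVar E) =
     det (map_mat mconst E * var_mat n XVar * transpose_mat (map_mat mconst E))"
| "rank_inverse_system n (WVar i j) = (var_mat n XVar * var_mat n YVar - 1\<^sub>m n) $$ (i, j)"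
| "rank_inverse_system n (UVar i j) =
     (hadamard (var_mat n XVar) (var_mat n XVar) - var_mat n XVar) $$ (i, j)"
| "rank_inverse_system n (VVar i j) =
     (hadamard (var_mat n YVar) (var_mat n YVar) - var_mat n YVar) $$ (i, j)"

end

theory Submission
  imports Defs
begin

text \<open>Put \<open>f(X) = 1 - C(X, I, 0, X - I, X \<odot> X - X, 0)\<close>. Since \<open>C\<close> vanishes at zero placeholders, \<open>f(I) = 1\<close>;
  since \<open>det\<^sub>r(EXE\<^sup>T) = 0\<close> whenever \<open>X\<close> factors through dimension less than \<open>r\<close>, \<open>f(X) = 0\<close> for such
  \<open>X\<close>. Hence \<open>f(A diag(z) B)\<close> is a nonzero polynomial in which every monomial contains at least \<open>r\<close> of the
  variables \<open>z\<^sub>k\<close>.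

  Berkowitz's recursion writes \<open>det\<^sub>m\<close> as the value of an algebraic branching program with
  \<open>(m + 1)\<^sup>3 \<le> r\<close> vertices, that is, as the last pivot of a matrix of affine forms
  \<open>X = L diag(1, \<dots>, 1, 1 + \<epsilon> det\<^sub>m, 1, \<dots>) U\<close> with \<open>L\<close>, \<open>U\<close> unipotent. Scaling rows and columns of \<open>X\<close> by
  rapidly increasing powers of \<open>\<epsilon>\<close> makes \<open>L\<close> and \<open>U\<close> trivial modulo a high power of \<open>\<epsilon>\<close> and lets a single
  \<open>z\<close>-monomial of \<open>f(A diag(z) B)\<close> dominate, so the leading term is a constant times
  \<open>(1 + \<epsilon> det\<^sub>m)\<^sup>e\<close> with \<open>e > 0\<close>, provided the pivot sits at an index which occurs in that monomial. Writing
  \<open>e = p^k e'\<close> with \<open>e'\<close> prime to the characteristic \<open>p\<close> (\<open>e = e'\<close> in characteristic 0), the first nonconstant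
  term is \<open>e' (\<epsilon> det\<^sub>m)^(p^k)\<close>, which is extracted by rescaling. This turns a border formula for
  \<open>C\<close> into one for that power of \<open>det\<^sub>m\<close>, each leaf growing by a factor \<open>O(m\<^sup>2)\<close>.\<close>

subsection \<open>Evaluation of polynomials\<close>

definition mmon :: "('v \<Rightarrow> 'r::comm_ring_1) \<Rightarrow> ('v \<Rightarrow>\<^sub>0 nat) \<Rightarrow> 'r" where
  "mmon \<sigma> m = (\<Prod>v\<in>Poly_Mapping.keys m. \<sigma> v ^ Poly_Mapping.lookup m v)"

text \<open>The coefficient map \<open>h\<close> is a parameter beside the point
  \<open>\<sigma>\<close> because the same refutation is evaluated over the base field, over
  polynomial rings and over polynomials with Laurent coefficients. Substitution is the case
  \<open>h = mconst\<close>.\<close>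

definition meval :: "('a::comm_ring_1 \<Rightarrow> 'r::comm_ring_1) \<Rightarrow> ('v \<Rightarrow> 'r) \<Rightarrow> ('v, 'a) mpoly \<Rightarrow> 'r" where
  "meval h \<sigma> p = (\<Sum>m\<in>Poly_Mapping.keys p. h (Poly_Mapping.lookup p m) * mmon \<sigma> m)"

lemma msubst_eq_meval: "msubst \<sigma> p = meval mconst \<sigma> p"
  by (simp add: msubst_def meval_def mmon_def)

lemma mmon_superset:
  assumes "finite V" "Poly_Mapping.keys m \<subseteq> V"
  shows "mmon \<sigma> m = (\<Prod>v\<in>V. \<sigma> v ^ Poly_Mapping.lookup m v)"
  unfolding mmon_def using assms
  by (intro prod.mono_neutral_left) (auto simp: in_keys_iff)

lemma mmon_0 [simp]: "mmon \<sigma> 0 = 1"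
  by (simp add: mmon_def)

lemma mmon_add: "mmon \<sigma> (m + m') = mmon \<sigma> m * mmon \<sigma> m'"
proof -
  let ?V = "Poly_Mapping.keys m \<union> Poly_Mapping.keys m'"
  have "Poly_Mapping.keys (m + m') \<subseteq> ?V" by (rule Poly_Mapping.keys_add)
  then show ?thesis
    by (simp add: mmon_superset[of ?V] lookup_add power_add prod.distrib)
qed

lemma mpoly_decomp: "p = (\<Sum>m\<in>Poly_Mapping.keys p. Poly_Mapping.single m (Poly_Mapping.lookup p m))"
  by (rule poly_mapping_eqI)
     (auto simp: lookup_sum lookup_single when_def sum.delta in_keys_iff
        intro: sum.neutral)

lemma mpoly_mult_decomp:
  "p * q = (\<Sum>m\<in>Poly_Mapping.keys p. \<Sum>m'\<in>Poly_Mapping.keys q.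
      Poly_Mapping.single (m + m') (Poly_Mapping.lookup p m * Poly_Mapping.lookup q m'))"
proof -
  have "p * q = (\<Sum>m\<in>Poly_Mapping.keys p. Poly_Mapping.single m (Poly_Mapping.lookup p m)) *
     (\<Sum>m\<in>Poly_Mapping.keys q. Poly_Mapping.single m (Poly_Mapping.lookup q m))"
    using mpoly_decomp[of p] mpoly_decomp[of q] by simp
  then show ?thesis by (simp add: sum_product mult_single)
qed

lemma mconst_0 [simp]: "mconst 0 = 0"
  by (simp add: mconst_def)

lemma mconst_1 [simp]: "mconst 1 = 1"
  by (simp add: mconst_def)

lemma mconst_add: "mconst (a + b) = mconst a + mconst b"
  by (simp add: mconst_def single_add)

lemma mconst_mult: "mconst (a * b) = mconst a * mconst b"
  by (simp add: mconst_def mult_single)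

lemma comm_ring_hom_mconst: "comm_ring_hom (mconst :: 'a::comm_ring_1 \<Rightarrow> ('v, 'a) mpoly)"
  by unfold_locales (simp_all add: mconst_add mconst_mult)

interpretation mconst_hom: comm_ring_hom "mconst :: 'a::comm_ring_1 \<Rightarrow> ('v, 'a) mpoly"
  by (rule comm_ring_hom_mconst)

lemma comm_ring_hom_comp: "comm_ring_hom f \<Longrightarrow> comm_ring_hom g \<Longrightarrow> comm_ring_hom (g \<circ> f)"
proof -
  assume "comm_ring_hom f" "comm_ring_hom g"
  then interpret f: comm_ring_hom f + g: comm_ring_hom g by auto
  show ?thesis by unfold_locales (simp_all add: f.hom_add g.hom_add f.hom_mult g.hom_mult)
qed

context
  fixes h :: "'a::comm_ring_1 \<Rightarrow> 'r::comm_ring_1"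
  assumes h: "comm_ring_hom h"
begin

interpretation comm_ring_hom h by (rule h)

lemma meval_superset:
  assumes "finite M" "Poly_Mapping.keys p \<subseteq> M"
  shows "meval h \<sigma> p = (\<Sum>m\<in>M. h (Poly_Mapping.lookup p m) * mmon \<sigma> m)"
  unfolding meval_def using assms
  by (intro sum.mono_neutral_left) (auto simp: in_keys_iff)

lemma meval_0 [simp]: "meval h \<sigma> 0 = 0"
  by (simp add: meval_def)

lemma meval_add: "meval h \<sigma> (p + q) = meval h \<sigma> p + meval h \<sigma> q"
proof -
  let ?V = "Poly_Mapping.keys p \<union> Poly_Mapping.keys q"
  have "Poly_Mapping.keys (p + q) \<subseteq> ?V" by (rule Poly_Mapping.keys_add)
  then show ?thesis
    by (simp add: meval_superset[of ?V] lookup_add hom_add distrib_right sum.distrib)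
qed

lemma meval_sum: "meval h \<sigma> (\<Sum>i\<in>A. f i) = (\<Sum>i\<in>A. meval h \<sigma> (f i))"
  by (induction A rule: infinite_finite_induct) (auto simp: meval_add)

lemma meval_single: "meval h \<sigma> (Poly_Mapping.single m c) = h c * mmon \<sigma> m"
  by (cases "c = 0") (simp_all add: meval_def)

lemma meval_mult: "meval h \<sigma> (p * q) = meval h \<sigma> p * meval h \<sigma> q"
proof -
  have "meval h \<sigma> (p * q) = (\<Sum>m\<in>Poly_Mapping.keys p. \<Sum>m'\<in>Poly_Mapping.keys q.
      h (Poly_Mapping.lookup p m * Poly_Mapping.lookup q m') * mmon \<sigma> (m + m'))"
    by (subst mpoly_mult_decomp) (simp only: meval_sum meval_single)
  also have "\<dots> = meval h \<sigma> p * meval h \<sigma> q"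
    by (simp add: meval_def sum_product hom_mult mmon_add mult_ac)
  finally show ?thesis .
qed

lemma meval_mconst [simp]: "meval h \<sigma> (mconst c) = h c"
  by (simp add: mconst_def meval_single)

lemma meval_mvar [simp]: "meval h \<sigma> (mvar v) = \<sigma> v"
  by (simp add: mvar_def meval_single mmon_def)

lemma comm_ring_hom_meval: "comm_ring_hom (meval h \<sigma>)"
proof
  show "meval h \<sigma> 1 = 1" using meval_mconst[of \<sigma> 1] by simp
qed (simp_all add: meval_add meval_mult)

lemma hom_meval:
  assumes "comm_ring_hom H"
  shows "H (meval h \<sigma> p) = meval (H \<circ> h) (H \<circ> \<sigma>) p"
proof -
  interpret H: comm_ring_hom H by fact
  show ?thesis
    by (simp add: meval_def mmon_def H.hom_sum H.hom_mult H.hom_prod H.hom_power)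
qed

lemma meval_map:
  assumes "f 0 = 0"
  shows "meval h \<sigma> (Poly_Mapping.map f p) = (\<Sum>m\<in>Poly_Mapping.keys p. h (f (Poly_Mapping.lookup p m)) * mmon \<sigma> m)"
proof -
  have *: "Poly_Mapping.lookup (Poly_Mapping.map f p) m = f (Poly_Mapping.lookup p m)" for m
    using assms by (simp add: Poly_Mapping.map.rep_eq when_def)
  have "Poly_Mapping.keys (Poly_Mapping.map f p) \<subseteq> Poly_Mapping.keys p"
    by (auto simp: in_keys_iff * assms)
  then show ?thesis by (simp add: meval_superset[of "Poly_Mapping.keys p"] *)
qed

end

lemma meval_cong:
  assumes "\<And>v. v \<in> mvars p \<Longrightarrow> \<sigma> v = \<tau> v"
  shows "meval h \<sigma> p = meval h \<tau> p"
  unfolding meval_def mmon_def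
  by (intro sum.cong refl arg_cong2[of _ _ _ _ "(*)"] prod.cong)
     (use assms in \<open>force simp: mvars_def\<close>)

text \<open>Monomials using a variable outside \<open>S\<close> become zero and all others stay as
  they are, so nothing merges into the term at \<open>\<mu>\<close> or cancels it.\<close>

lemma lookup_meval_kill:
  fixes p :: "('v, 'a::comm_ring_1) mpoly"
  assumes "Poly_Mapping.keys \<mu> \<subseteq> S"
  shows "Poly_Mapping.lookup (meval mconst (\<lambda>v. if v \<in> S then mvar v else 0) p) \<mu> = Poly_Mapping.lookup p \<mu>"
proof -
  have pw: "(mvar v :: ('v, 'a) mpoly) ^ k = Poly_Mapping.single (Poly_Mapping.single v k) 1" for v k
    by (induction k) (simp_all add: mvar_def mult_single single_add[symmetric])
  have pr: "(\<Prod>v\<in>V. (mvar v :: ('v, 'a) mpoly) ^ k v)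
      = Poly_Mapping.single (\<Sum>v\<in>V. Poly_Mapping.single v (k v)) 1" if "finite V" for V k
    using that by (induction V rule: finite_induct) (simp_all add: pw mult_single)
  let ?\<sigma> = "\<lambda>v. if v \<in> S then mvar v else (0 :: ('v, 'a) mpoly)"
  have mm: "mmon ?\<sigma> m = (if Poly_Mapping.keys m \<subseteq> S then Poly_Mapping.single m 1 else 0)" for m
  proof (cases "Poly_Mapping.keys m \<subseteq> S")
    case True
    then have "mmon ?\<sigma> m = (\<Prod>v\<in>Poly_Mapping.keys m. mvar v ^ Poly_Mapping.lookup m v)"
      unfolding mmon_def by (intro prod.cong) auto
    also have "\<dots> = Poly_Mapping.single m 1"
      using mpoly_decomp[of m] by (simp add: pr)
    finally show ?thesis using True by simp
  next
    case False
    then obtain v where "v \<in> Poly_Mapping.keys m" "v \<notin> S" by auto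
    then have "mmon ?\<sigma> m = 0" unfolding mmon_def
      by (intro prod_zero) (auto intro!: bexI[of _ v] simp: in_keys_iff zero_power)
    then show ?thesis using False by simp
  qed
  have "Poly_Mapping.lookup (meval mconst ?\<sigma> p) \<mu>
      = (\<Sum>m\<in>Poly_Mapping.keys p. if m = \<mu> then Poly_Mapping.lookup p m else 0)"
    unfolding meval_def lookup_sum
    by (intro sum.cong refl) (use assms in \<open>auto simp: mm mconst_def mult_single lookup_single when_def\<close>)
  also have "\<dots> = Poly_Mapping.lookup p \<mu>"
    by (simp add: sum.delta in_keys_iff)
  finally show ?thesis .
qed

subsection \<open>Integral polynomials\<close>

text \<open>Polynomials over the power series ring, kept inside the ring with Laurent coefficients
  so that division by powers of \<epsilon> remains possible. Congruence modulo \<epsilon>^G is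
  stated below as adding \<epsilon>^G times a member of this set.\<close>

definition integral_mpoly :: "'v set \<Rightarrow> ('v, 'a::field fls) mpoly set" where
  "integral_mpoly Vs = {p. mvars p \<subseteq> Vs \<and> (\<forall>m. Poly_Mapping.lookup p m \<in> range fps_to_fls)}"

lemma range_fps_to_fls:
  "(0 :: 'a::field fls) \<in> range fps_to_fls" "(1 :: 'a fls) \<in> range fps_to_fls"
  "x \<in> range fps_to_fls \<Longrightarrow> y \<in> range fps_to_fls \<Longrightarrow> x + y \<in> range fps_to_fls"
  "x \<in> range fps_to_fls \<Longrightarrow> y \<in> range fps_to_fls \<Longrightarrow> (x * y :: 'a fls) \<in> range fps_to_fls"
  "x \<in> range fps_to_fls \<Longrightarrow> (- x :: 'a fls) \<in> range fps_to_fls"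
proof -
  show "(0 :: 'a::field fls) \<in> range fps_to_fls" by (rule range_eqI[of _ _ 0]) simp
  show "(1 :: 'a::field fls) \<in> range fps_to_fls" by (rule range_eqI[of _ _ 1]) simp
  show "x \<in> range fps_to_fls \<Longrightarrow> y \<in> range fps_to_fls \<Longrightarrow> x + y \<in> range fps_to_fls"
    by (auto simp flip: fps_to_fls_plus)
  show "x \<in> range fps_to_fls \<Longrightarrow> y \<in> range fps_to_fls \<Longrightarrow> (x * y :: 'a fls) \<in> range fps_to_fls"
    by (auto simp flip: fls_times_fps_to_fls)
  show "x \<in> range fps_to_fls \<Longrightarrow> (- x :: 'a fls) \<in> range fps_to_fls"
    by (auto simp flip: fps_to_fls_uminus)
qed

lemma range_fps_to_fls_sum:
  "(\<And>i. i \<in> A \<Longrightarrow> f i \<in> range fps_to_fls) \<Longrightarrow> (\<Sum>i\<in>A. f i :: 'a::field fls) \<in> range fps_to_fls"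
  by (induction A rule: infinite_finite_induct) (auto simp: range_fps_to_fls)

lemma mvars_mult: "mvars (p * q) \<subseteq> mvars p \<union> mvars (q :: ('v, 'a::comm_ring_1) mpoly)"
proof
  fix v assume "v \<in> mvars (p * q)"
  then obtain m where m: "m \<in> Poly_Mapping.keys (p * q)" "v \<in> Poly_Mapping.keys m"
    by (auto simp: mvars_def)
  then obtain a b where "m = a + b" "a \<in> Poly_Mapping.keys p" "b \<in> Poly_Mapping.keys q"
    using Poly_Mapping.keys_mult[of p q] by blast
  then show "v \<in> mvars p \<union> mvars q"
    using m(2) Poly_Mapping.keys_add[of a b] by (auto simp: mvars_def)
qed

lemma mvars_add: "mvars (p + q) \<subseteq> mvars p \<union> mvars q"
  using Poly_Mapping.keys_add[of p q] by (auto simp: mvars_def)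

lemma mvars_uminus [simp]: "mvars (- p :: ('v, 'a::comm_ring_1) mpoly) = mvars p"
  by (auto simp: mvars_def in_keys_iff)

lemma mvars_mconst [simp]: "mvars (mconst c) = {}"
  by (auto simp: mvars_def mconst_def split: if_splits)

lemma mvars_mvar [simp]: "mvars (mvar v :: ('v, 'a::comm_ring_1) mpoly) = {v}"
  by (auto simp: mvars_def mvar_def)

named_theorems integral

lemma integral_mconst: "c \<in> range fps_to_fls \<Longrightarrow> mconst c \<in> integral_mpoly Vs"
  by (auto simp: integral_mpoly_def mconst_def lookup_single when_def range_fps_to_fls
        mvars_mconst[unfolded mconst_def])

lemma integral_0 [integral]: "0 \<in> integral_mpoly Vs"
  and integral_1 [integral]: "1 \<in> integral_mpoly Vs"
  using integral_mconst[OF range_fps_to_fls(1)] integral_mconst[OF range_fps_to_fls(2)] by auto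

lemma integral_mvar [integral]: "v \<in> Vs \<Longrightarrow> mvar v \<in> integral_mpoly Vs"
  using mvars_mvar[of v] unfolding integral_mpoly_def
  by (auto simp: mvar_def lookup_single when_def range_fps_to_fls mvars_mvar)

lemma integral_add [integral]:
  "p \<in> integral_mpoly Vs \<Longrightarrow> q \<in> integral_mpoly Vs \<Longrightarrow> p + q \<in> integral_mpoly Vs"
  using mvars_add[of p q] by (auto simp: integral_mpoly_def lookup_add range_fps_to_fls)

lemma integral_uminus [integral]: "p \<in> integral_mpoly Vs \<Longrightarrow> - p \<in> integral_mpoly Vs"
  by (auto simp: integral_mpoly_def range_fps_to_fls)

lemma integral_diff [integral]:
  "p \<in> integral_mpoly Vs \<Longrightarrow> q \<in> integral_mpoly Vs \<Longrightarrow> p - q \<in> integral_mpoly Vs"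
  using integral_add[OF _ integral_uminus, of p Vs q] by simp

lemma integral_mult [integral]:
  assumes "p \<in> integral_mpoly Vs" "q \<in> integral_mpoly Vs"
  shows "p * q \<in> integral_mpoly Vs"
proof -
  have "Poly_Mapping.lookup (p * q) m \<in> range fps_to_fls" for m
    using assms unfolding mpoly_mult_decomp lookup_sum lookup_single integral_mpoly_def
    by (auto intro!: range_fps_to_fls_sum simp: when_def range_fps_to_fls)
  then show ?thesis using assms mvars_mult[of p q] by (auto simp: integral_mpoly_def)
qed

lemma integral_power [integral]: "p \<in> integral_mpoly Vs \<Longrightarrow> p ^ k \<in> integral_mpoly Vs"
  by (induction k) (auto intro: integral)

lemma integral_sum [integral]:
  "(\<And>i. i \<in> A \<Longrightarrow> f i \<in> integral_mpoly Vs) \<Longrightarrow> (\<Sum>i\<in>A. f i) \<in> integral_mpoly Vs"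
  by (induction A rule: infinite_finite_induct) (auto intro: integral)

lemma integral_prod [integral]:
  "(\<And>i. i \<in> A \<Longrightarrow> f i \<in> integral_mpoly Vs) \<Longrightarrow> (\<Prod>i\<in>A. f i) \<in> integral_mpoly Vs"
  by (induction A rule: infinite_finite_induct) (auto intro: integral)

lemma integral_of_nat [integral]: "of_nat k \<in> integral_mpoly Vs"
  by (induction k) (auto intro: integral)

lemma integral_fls_const [integral]: "mconst (fls_const c) \<in> integral_mpoly Vs"
  by (rule integral_mconst, rule range_eqI[of _ _ "fps_const c"]) simp

lemma integral_fls_X [integral]: "mconst fls_X \<in> integral_mpoly Vs"
  by (rule integral_mconst, rule range_eqI[of _ _ "fps_X"]) simp

lemma integral_mmon:
  "(\<And>v. v \<in> Poly_Mapping.keys m \<Longrightarrow> \<sigma> v \<in> integral_mpoly Vs) \<Longrightarrow> mmon \<sigma> m \<in> integral_mpoly Vs"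
  unfolding mmon_def by (intro integral)

text \<open>Returns a remainder to the form required by \<open>border_computes\<close>. Taking
  regular parts loses nothing, since every coefficient already is a power series.\<close>

lemma integral_mpolyE:
  assumes "p \<in> integral_mpoly Vs"
  obtains g :: "('v, 'a::field fps) mpoly" where "mvars g \<subseteq> Vs" "p = Poly_Mapping.map fps_to_fls g"
proof
  let ?g = "Poly_Mapping.map fls_regpart p"
  have l: "Poly_Mapping.lookup ?g m = fls_regpart (Poly_Mapping.lookup p m)" for m
    by (simp add: Poly_Mapping.map.rep_eq when_def)
  show "mvars ?g \<subseteq> Vs" using assms
    by (force simp: integral_mpoly_def mvars_def in_keys_iff l)
  show "p = Poly_Mapping.map fps_to_fls ?g"
  proof (rule poly_mapping_eqI)
    fix m
    have "Poly_Mapping.lookup p m \<in> range fps_to_fls" using assms by (auto simp: integral_mpoly_def)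
    then obtain f where "Poly_Mapping.lookup p m = fps_to_fls f" by auto
    then show "Poly_Mapping.lookup p m = Poly_Mapping.lookup (Poly_Mapping.map fps_to_fls ?g) m"
      by (simp add: Poly_Mapping.map.rep_eq l when_def)
  qed
qed

subsection \<open>Specialising the refutation to Y = I\<close>

text \<open>Padding the inner dimension with zeros from \<open>card s\<close> up to \<open>r\<close>
  makes \<open>M\<close> a product of two square matrices, the second having a zero row. No notion
  of rank is involved, so this works over any commutative ring, in particular over
  polynomials.\<close>

lemma det_eq_0_of_low_rank:
  fixes M :: "'r::comm_ring_1 mat"
  assumes M: "M \<in> carrier_mat r r" and s: "finite s" "card s < r"
    and eq: "\<And>i l. i < r \<Longrightarrow> l < r \<Longrightarrow> M $$ (i, l) = (\<Sum>k\<in>s. p i k * q k l)"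
  shows "det M = 0"
proof -
  obtain f where f: "bij_betw f {..<card s} s"
    using ex_bij_betw_nat_finite[OF s(1)] by (auto simp: atLeast0LessThan)
  define P where "P = mat r r (\<lambda>(i, j). if j < card s then p i (f j) else 0)"
  define Q where "Q = mat r r (\<lambda>(j, l). if j < card s then q (f j) l else 0)"
  have [simp]: "P \<in> carrier_mat r r" "Q \<in> carrier_mat r r" by (auto simp: P_def Q_def)
  have "M = P * Q"
  proof (rule eq_matI)
    fix i l assume il: "i < dim_row (P * Q)" "l < dim_col (P * Q)"
    then have il': "i < r" "l < r" by (auto simp: P_def Q_def)
    have "(P * Q) $$ (i, l) = (\<Sum>j<r. P $$ (i, j) * Q $$ (j, l))"
      using il' by (simp add: P_def Q_def scalar_prod_def atLeast0LessThan)
    also have "\<dots> = (\<Sum>j<r. if j < card s then p i (f j) * q (f j) l else 0)"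
      using il' by (intro sum.cong) (auto simp: P_def Q_def)
    also have "\<dots> = (\<Sum>j<card s. p i (f j) * q (f j) l)"
      using s(2) by (intro sum.mono_neutral_cong_right) auto
    also have "\<dots> = (\<Sum>k\<in>s. p i k * q k l)"
      by (rule sum.reindex_bij_betw[OF f])
    finally show "M $$ (i, l) = (P * Q) $$ (i, l)" using eq[OF il'] by simp
  qed (use M in \<open>auto simp: P_def Q_def\<close>)
  moreover have "det Q = 0"
  proof -
    have "Q = mat\<^sub>r r r (\<lambda>i. if i = card s then 0\<^sub>v r else row Q i)"
      by (rule eq_matI) (auto simp: Q_def)
    moreover have "row Q \<in> {0..<r} \<rightarrow> carrier_vec r" by (simp add: Q_def row_def)
    ultimately show ?thesis using det_row_0[OF s(2)] by metis
  qed
  ultimately show ?thesis by (simp add: det_mult[of P r Q])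
qed

text \<open>Together with \<open>placeholder_point\<close> this is the point (X, I, 0, X - I, X o X
  - X, 0), with o the entrywise product. The last three groups are the values of their equations at
  Y = I, while the determinant placeholders are set to 0, the value of those equations on matrices
  of rank below \<open>r\<close>.\<close>

primrec base_point :: "(nat \<Rightarrow> nat \<Rightarrow> 'r::comm_ring_1) \<Rightarrow> base_var \<Rightarrow> 'r" where
  "base_point x (XVar i j) = x i j"
| "base_point x (YVar i j) = of_bool (i = j)"

primrec placeholder_point :: "(nat \<Rightarrow> nat \<Rightarrow> 'r::comm_ring_1) \<Rightarrow> 'a placeholder \<Rightarrow> 'r" where
  "placeholder_point x (ZVar E) = 0"
| "placeholder_point x (WVar i j) = x i j - of_bool (i = j)"
| "placeholder_point x (UVar i j) = x i j * x i j - x i j"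
| "placeholder_point x (VVar i j) = 0"

definition refutation_at ::
    "('a::comm_ring_1 \<Rightarrow> 'r::comm_ring_1) \<Rightarrow> (nat \<Rightarrow> nat \<Rightarrow> 'r) \<Rightarrow> (base_var + 'a placeholder, 'a) mpoly \<Rightarrow> 'r" where
  "refutation_at h x C = meval h (case_sum (base_point x) (placeholder_point x)) C"

lemma hom_refutation_at:
  assumes "comm_ring_hom h" "comm_ring_hom H"
  shows "H (refutation_at h x C) = refutation_at (H \<circ> h) (\<lambda>i j. H (x i j)) C"
proof -
  interpret H: comm_ring_hom H by fact
  have "(H \<circ> case_sum (base_point x) (placeholder_point x))
      = case_sum (base_point (\<lambda>i j. H (x i j))) (placeholder_point (\<lambda>i j. H (x i j)) :: 'a placeholder \<Rightarrow> _)"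
  proof
    fix v :: "base_var + 'a placeholder"
    show "(H \<circ> case_sum (base_point x) (placeholder_point x)) v
      = case_sum (base_point (\<lambda>i j. H (x i j))) (placeholder_point (\<lambda>i j. H (x i j))) v"
    proof (cases v)
      case (Inl b) then show ?thesis by (cases b) auto
    next
      case (Inr b) then show ?thesis by (cases b) (auto simp: H.hom_minus H.hom_mult)
    qed
  qed
  then show ?thesis
    unfolding refutation_at_def by (simp add: hom_meval[OF assms])
qed

lemma mat_meval_var_mat:
  assumes "comm_ring_hom h"
  shows "map_mat (meval h \<sigma>) (var_mat n v) = mat n n (\<lambda>(i, j). \<sigma> (v i j))"
  by (rule eq_matI) (auto simp: var_mat_def meval_mvar[OF assms])

lemma meval_det_system:
  assumes h: "comm_ring_hom h" and E: "dim_row E = r" "dim_col E = n"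
  shows "meval h \<sigma> (rank_inverse_system n (ZVar E))
     = det (map_mat h E * mat n n (\<lambda>(i, j). \<sigma> (XVar i j)) * transpose_mat (map_mat h E))"
proof -
  interpret s: comm_ring_hom "meval h \<sigma>" by (rule comm_ring_hom_meval[OF h])
  have E': "E \<in> carrier_mat r n" using E by auto
  have m: "map_mat (meval h \<sigma>) (map_mat mconst E) = map_mat h E"
    by (rule eq_matI) (auto simp: meval_mconst[OF h])
  have t: "map_mat (meval h \<sigma>) (transpose_mat (map_mat mconst E)) = transpose_mat (map_mat h E)"
    by (rule eq_matI) (auto simp: meval_mconst[OF h])
  have "meval h \<sigma> (rank_inverse_system n (ZVar E))
     = det (map_mat (meval h \<sigma>) (map_mat mconst E * var_mat n XVar * transpose_mat (map_mat mconst E)))"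
    by (simp add: s.hom_det)
  also have "\<dots> = det (map_mat (meval h \<sigma>) (map_mat mconst E * var_mat n XVar)
        * map_mat (meval h \<sigma>) (transpose_mat (map_mat mconst E)))"
    using E' by (subst s.mat_hom_mult[of _ r n _ r]) (auto simp: var_mat_def)
  also have "map_mat (meval h \<sigma>) (map_mat mconst E * var_mat n XVar)
       = map_mat (meval h \<sigma>) (map_mat mconst E) * map_mat (meval h \<sigma>) (var_mat n XVar)"
    using E' by (subst s.mat_hom_mult[of _ r n _ n]) (auto simp: var_mat_def)
  finally show ?thesis by (simp add: m t mat_meval_var_mat[OF h])
qed

locale refutation =
  fixes n r :: nat and \<E> :: "'a::field mat set" and C :: "(base_var + 'a placeholder, 'a) mpoly"
  assumes dims: "\<And>E. E \<in> \<E> \<Longrightarrow> dim_row E = r \<and> dim_col E = n"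
    and refutation: "ips_refutation (base_vars n) (placeholders n \<E>) (rank_inverse_system n) C"
begin

lemma mvars_subset: "mvars C \<subseteq> Inl ` base_vars n \<union> Inr ` placeholders n \<E>"
  using refutation by (simp add: ips_refutation_def)

lemma meval_refutation:
  assumes h: "comm_ring_hom h"
  shows "meval h (case_sum \<sigma> (\<lambda>_. 0)) C = 0"
    and "meval h (case_sum \<sigma> (\<lambda>f. meval h \<sigma> (rank_inverse_system n f))) C = 1"
proof -
  interpret s: comm_ring_hom "meval h \<sigma>" by (rule comm_ring_hom_meval[OF h])
  interpret h: comm_ring_hom h by fact
  note hm = hom_meval[OF comm_ring_hom_mconst s.comm_ring_hom_axioms]
  have c: "meval h \<sigma> \<circ> mconst = h" by (auto simp: meval_mconst[OF h])
  have "meval h \<sigma> (msubst (case_sum mvar (\<lambda>_. 0)) C) = 0"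
    using refutation by (simp add: ips_refutation_def)
  moreover have "meval h \<sigma> \<circ> case_sum mvar (\<lambda>_ :: 'a placeholder. 0) = case_sum \<sigma> (\<lambda>_. 0)"
    by (rule ext) (auto simp: meval_mvar[OF h] split: sum.splits)
  ultimately show "meval h (case_sum \<sigma> (\<lambda>_. 0)) C = 0"
    by (simp add: msubst_eq_meval hm c)
  have "meval h \<sigma> (msubst (case_sum mvar (rank_inverse_system n)) C) = 1"
    using refutation by (simp add: ips_refutation_def)
  moreover have "meval h \<sigma> \<circ> case_sum mvar (rank_inverse_system n)
      = case_sum \<sigma> (\<lambda>f. meval h \<sigma> (rank_inverse_system n f))"
    by (auto simp: meval_mvar[OF h] split: sum.splits)
  ultimately show "meval h (case_sum \<sigma> (\<lambda>f. meval h \<sigma> (rank_inverse_system n f))) C = 1"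
    by (simp add: msubst_eq_meval hm c)
qed

lemma refutation_at_cong:
  assumes "\<And>i j. i < n \<Longrightarrow> j < n \<Longrightarrow> x i j = y i j"
  shows "refutation_at h x C = refutation_at h y C"
  unfolding refutation_at_def
  by (rule meval_cong)
     (use mvars_subset assms in \<open>fastforce simp: base_vars_def placeholders_def\<close>)

text \<open>At the identity all placeholder values vanish, so this is the first defining property of
  a refutation.\<close>

lemma refutation_at_one:
  assumes "comm_ring_hom h"
  shows "refutation_at h (\<lambda>i j. of_bool (i = j)) C = 0"
proof -
  have "placeholder_point (\<lambda>i j. of_bool (i = j)) = (\<lambda>_ :: 'a placeholder. 0 :: 'b)"
  proof
    fix p :: "'a placeholder"
    show "placeholder_point (\<lambda>i j. of_bool (i = j)) p = (0 :: 'b)" by (cases p) auto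
  qed
  then show ?thesis
    unfolding refutation_at_def using meval_refutation(1)[OF assms] by metis
qed

text \<open>A factorization of \<open>x\<close> through fewer than \<open>r\<close> dimensions
  passes to E x E^T, whose determinant therefore vanishes. All placeholders then hold the true
  values of their equations, where a refutation takes the value 1.\<close>

lemma refutation_at_low_rank:
  assumes h: "comm_ring_hom h" and s: "finite s" "card s < r"
    and x: "\<And>i j. i < n \<Longrightarrow> j < n \<Longrightarrow> x i j = (\<Sum>k\<in>s. p i k * q k j)"
  shows "refutation_at h x C = 1"
proof -
  interpret h: comm_ring_hom h by fact
  interpret m: comm_ring_hom "meval h (base_point x)" by (rule comm_ring_hom_meval[OF h])
  have var: "meval h (base_point x) (var_mat n v $$ (i, j)) = base_point x (v i j)"
    if "i < n" "j < n" for v i j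
    using that by (simp add: var_mat_def meval_mvar[OF h])
  have "case_sum (base_point x) (placeholder_point x) v
      = case_sum (base_point x) (\<lambda>f. meval h (base_point x) (rank_inverse_system n f)) v"
    if "v \<in> mvars C" for v
  proof (cases v)
    case (Inr f)
    then have f: "f \<in> placeholders n \<E>" using that mvars_subset by auto
    have "placeholder_point x f = meval h (base_point x) (rank_inverse_system n f)"
    proof (cases f)
      case (ZVar E)
      then have E: "dim_row E = r" "dim_col E = n" using f dims by (auto simp: placeholders_def)
      have "det (map_mat h E * mat n n (\<lambda>(i, j). x i j) * transpose_mat (map_mat h E)) = 0"
      proof (rule det_eq_0_of_low_rank[OF _ s])
        fix i l assume il: "i < r" "l < r"
        let ?e = "\<lambda>i j. h (E $$ (i, j))"
        have "(map_mat h E * mat n n (\<lambda>(i, j). x i j) * transpose_mat (map_mat h E)) $$ (i, l)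
          = (\<Sum>b<n. (\<Sum>a<n. ?e i a * x a b) * ?e l b)"
          using il E by (simp add: scalar_prod_def atLeast0LessThan)
        also have "\<dots> = (\<Sum>b<n. (\<Sum>a<n. \<Sum>k\<in>s. ?e i a * (p a k * q k b)) * ?e l b)"
          by (simp add: x sum_distrib_left)
        also have "\<dots> = (\<Sum>b<n. (\<Sum>k\<in>s. \<Sum>a<n. ?e i a * (p a k * q k b)) * ?e l b)"
          by (subst sum.swap) simp
        also have "\<dots> = (\<Sum>b<n. \<Sum>k\<in>s. \<Sum>a<n. ?e i a * (p a k * q k b) * ?e l b)"
          by (simp add: sum_distrib_right)
        also have "\<dots> = (\<Sum>k\<in>s. \<Sum>b<n. \<Sum>a<n. ?e i a * (p a k * q k b) * ?e l b)"
          by (rule sum.swap)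
        also have "\<dots> = (\<Sum>k\<in>s. (\<Sum>a<n. ?e i a * p a k) * (\<Sum>b<n. q k b * ?e l b))"
          by (subst sum_product, subst sum.swap) (simp add: mult_ac)
        finally show "(map_mat h E * mat n n (\<lambda>(i, j). x i j) * transpose_mat (map_mat h E)) $$ (i, l)
          = (\<Sum>k\<in>s. (\<Sum>a<n. ?e i a * p a k) * (\<Sum>b<n. q k b * ?e l b))" .
      qed (use E in auto)
      then show ?thesis by (simp add: ZVar meval_det_system[OF h E] del: rank_inverse_system.simps)
    next
      case (WVar i j)
      then have ij: "i < n" "j < n" using f by (auto simp: placeholders_def)
      have "(var_mat n XVar * var_mat n YVar - 1\<^sub>m n) $$ (i, j)
        = (\<Sum>k<n. var_mat n XVar $$ (i, k) * var_mat n YVar $$ (k, j)) - (mconst (of_bool (i = j)) :: (base_var, 'a) mpoly)"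
        using ij by (simp add: scalar_prod_def atLeast0LessThan var_mat_def)
      then show ?thesis using ij
        by (simp add: WVar m.hom_minus m.hom_sum m.hom_mult var meval_mconst[OF h] of_bool_def if_distrib
            sum.delta cong: if_cong)
    next
      case (UVar i j)
      then have ij: "i < n" "j < n" using f by (auto simp: placeholders_def)
      have "(hadamard (var_mat n XVar) (var_mat n XVar) - var_mat n XVar) $$ (i, j)
        = var_mat n XVar $$ (i, j) * var_mat n XVar $$ (i, j) - (var_mat n XVar $$ (i, j) :: (base_var, 'a) mpoly)"
        using ij by (simp add: hadamard_def var_mat_def)
      then show ?thesis using ij
        by (simp add: UVar m.hom_minus m.hom_mult var)
    next
      case (VVar i j)
      then have ij: "i < n" "j < n" using f by (auto simp: placeholders_def)
      have "(hadamard (var_mat n YVar) (var_mat n YVar) - var_mat n YVar) $$ (i, j)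
        = var_mat n YVar $$ (i, j) * var_mat n YVar $$ (i, j) - (var_mat n YVar $$ (i, j) :: (base_var, 'a) mpoly)"
        using ij by (simp add: hadamard_def var_mat_def)
      then show ?thesis using ij
        by (simp add: VVar m.hom_minus m.hom_mult var)
    qed
    then show ?thesis using Inr by simp
  qed auto
  then have "refutation_at h x C
     = meval h (case_sum (base_point x) (\<lambda>f. meval h (base_point x) (rank_inverse_system n f))) C"
    unfolding refutation_at_def by (rule meval_cong)
  then show ?thesis by (simp add: meval_refutation(2)[OF h])
qed

end

section \<open>The refutation in the coordinates A diag(z) B\<close>

datatype diag_var = AVar nat nat | DVar nat | BVar nat nat

instance diag_var :: countable
  by countable_datatype

context refutation
begin

text \<open>In these coordinates rank can be read off monomials: setting one \<open>DVar k\<close>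
  to zero removes a rank-one summand of the matrix.\<close>

definition diag_poly :: "(diag_var, 'a) mpoly" where
  "diag_poly = 1 - refutation_at mconst (\<lambda>i j. \<Sum>k<n. mvar (AVar i k) * mvar (DVar k) * mvar (BVar k j)) C"

lemma meval_diag_poly:
  assumes h: "comm_ring_hom h"
  shows "meval h \<tau> diag_poly
     = 1 - refutation_at h (\<lambda>i j. \<Sum>k<n. \<tau> (AVar i k) * \<tau> (DVar k) * \<tau> (BVar k j)) C"
proof -
  interpret m: comm_ring_hom "meval h \<tau>" by (rule comm_ring_hom_meval[OF h])
  have c: "meval h \<tau> \<circ> mconst = h" by (auto simp: meval_mconst[OF h])
  show ?thesis unfolding diag_poly_def
    by (simp add: m.hom_minus hom_refutation_at[OF comm_ring_hom_mconst m.comm_ring_hom_axioms] c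
        m.hom_sum m.hom_mult meval_mvar[OF h])
qed

text \<open>At A = B = I and z = 1 the matrix is the identity, where the value is 1 - 0.\<close>

lemma diag_poly_nonzero: "diag_poly \<noteq> 0"
proof
  assume 0: "diag_poly = 0"
  interpret id: comm_ring_hom "id :: 'a \<Rightarrow> 'a" by unfold_locales auto
  let ?\<tau> = "\<lambda>v. case v of AVar i j \<Rightarrow> of_bool (i = j) | DVar k \<Rightarrow> 1 | BVar i j \<Rightarrow> (of_bool (i = j) :: 'a)"
  have "refutation_at id (\<lambda>i j. \<Sum>k<n. ?\<tau> (AVar i k) * ?\<tau> (DVar k) * ?\<tau> (BVar k j)) C
      = refutation_at id (\<lambda>i j. of_bool (i = j) :: 'a) C"
    by (rule refutation_at_cong) (auto simp: of_bool_def if_distrib cong: if_cong)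
  then have "meval id ?\<tau> diag_poly = 1"
    unfolding meval_diag_poly[OF id.comm_ring_hom_axioms]
    by (simp add: refutation_at_one[OF id.comm_ring_hom_axioms])
  then show False by (simp add: 0 meval_def)
qed

text \<open>Kill every \<open>DVar\<close> missing from \<open>\<mu>\<close>. The coefficient at
  \<open>\<mu>\<close> survives, but with fewer than \<open>r\<close> indices left the matrix has
  low rank and the whole polynomial becomes 1 - 1.\<close>

lemma diag_poly_support:
  assumes \<mu>: "\<mu> \<in> Poly_Mapping.keys diag_poly"
  shows "r \<le> card {k. k < n \<and> Poly_Mapping.lookup \<mu> (DVar k) \<noteq> 0}"
proof (rule ccontr)
  let ?s = "{k. k < n \<and> Poly_Mapping.lookup \<mu> (DVar k) \<noteq> 0}"
  let ?\<tau> = "\<lambda>v. if v \<in> Poly_Mapping.keys \<mu> \<union> range (case_prod AVar) \<union> range (case_prod BVar) then mvar v else 0 :: (diag_var, 'a) mpoly"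
  assume "\<not> r \<le> card ?s"
  then have "refutation_at mconst (\<lambda>i j. \<Sum>k<n. ?\<tau> (AVar i k) * ?\<tau> (DVar k) * ?\<tau> (BVar k j)) C = 1"
  proof (intro refutation_at_low_rank[OF comm_ring_hom_mconst, of ?s])
    fix i j
    show "(\<Sum>k<n. ?\<tau> (AVar i k) * ?\<tau> (DVar k) * ?\<tau> (BVar k j))
      = (\<Sum>k\<in>?s. (?\<tau> (AVar i k) * ?\<tau> (DVar k)) * ?\<tau> (BVar k j))"
      by (rule sum.mono_neutral_right) (auto simp: in_keys_iff)
  qed auto
  then have "meval mconst ?\<tau> diag_poly = 0"
    unfolding meval_diag_poly[OF comm_ring_hom_mconst] by simp
  then have "Poly_Mapping.lookup diag_poly \<mu> = 0"
    using lookup_meval_kill[of \<mu> "Poly_Mapping.keys \<mu> \<union> range (case_prod AVar) \<union> range (case_prod BVar)" diag_poly]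
    by auto
  with \<mu> show False by (simp add: in_keys_iff)
qed

end

subsection \<open>Berkowitz's recursion for the determinant\<close>

text \<open>The coefficients of the difference vanish one after another from the lowest up. Zero
  divisors in the coefficient ring do no harm.\<close>

lemma fps_mult_left_cancel_unit:
  fixes f g h :: "'r::comm_ring_1 fps"
  assumes f: "fps_nth f 0 = 1" and eq: "f * g = f * h"
  shows "g = h"
proof -
  have 0: "f * (g - h) = 0" using eq by (simp add: right_diff_distrib)
  have "fps_nth (g - h) n = 0" for n
  proof (induction n rule: less_induct)
    case (less n)
    have "0 = fps_nth (f * (g - h)) n" using 0 by simp
    also have "\<dots> = (\<Sum>i=0..n. fps_nth f i * fps_nth (g - h) (n - i))" by (rule fps_mult_nth)
    also have "\<dots> = (\<Sum>i\<in>{0}. fps_nth f i * fps_nth (g - h) (n - i))"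
      by (rule sum.mono_neutral_right) (use less in auto)
    finally show ?case using f by simp
  qed
  then show ?thesis by (auto simp: fps_eq_iff)
qed

text \<open>The determinant of this matrix is the reversed characteristic polynomial of the leading
  \<open>i\<close> by \<open>i\<close> block. Its constant term 1 makes it cancellable among power
  series.\<close>

definition rev_char_mat :: "(nat \<Rightarrow> nat \<Rightarrow> 'r::comm_ring_1) \<Rightarrow> nat \<Rightarrow> 'r fps mat" where
  "rev_char_mat A i = mat i i (\<lambda>(a, b). of_bool (a = b) - fps_X * fps_const (A a b))"

text \<open>With B the leading \<open>i\<close> by \<open>i\<close> block of \<open>A\<close>, a the
  part of column \<open>i\<close> above the diagonal and D = det(1 - tB), this is the coefficient of
  t^d in entry \<open>v\<close> of the solution s of (1 - tB) s = t D a. Equivalently, s = t adj(1 -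
  tB) a.\<close>

primrec border_sol :: "(nat \<Rightarrow> nat \<Rightarrow> 'r::comm_ring_1) \<Rightarrow> nat \<Rightarrow> nat \<Rightarrow> nat \<Rightarrow> 'r" where
  "border_sol A i 0 = (\<lambda>v. 0)"
| "border_sol A i (Suc d) = (\<lambda>v. A v i * fps_nth (det (rev_char_mat A i)) d
      + (\<Sum>u<i. A v u * border_sol A i d u))"

lemma det_rev_char_mat_0 [simp]: "det (rev_char_mat A 0) = 1"
  by (rule det_dim_zero) (simp add: rev_char_mat_def)

text \<open>Multiplying by the upper triangular \<open>T\<close>, whose last column is the border
  solution followed by \<open>D i\<close>, clears the last column of \<open>N\<close> above the
  diagonal. Comparing determinants gives \<open>D i * det N = D i * new\<close>, and
  \<open>D i\<close> cancels by its constant term.\<close>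

lemma det_rev_char_mat_Suc_aux:
  fixes A :: "nat \<Rightarrow> nat \<Rightarrow> 'r::comm_ring_1"
  defines "D \<equiv> \<lambda>i. det (rev_char_mat A i)"
  assumes D0: "fps_nth (D i) 0 = 1"
  shows "D (Suc i) = D i * (1 - fps_X * fps_const (A i i))
     - fps_X * (\<Sum>v<i. fps_const (A i v) * Abs_fps (\<lambda>d. border_sol A i d v))"
proof -
  define S where "S = (\<lambda>v. Abs_fps (\<lambda>d. border_sol A i d v))"
  define new where "new = D i * (1 - fps_X * fps_const (A i i)) - fps_X * (\<Sum>v<i. fps_const (A i v) * S v)"
  define N where "N = rev_char_mat A (Suc i)"
  define T where "T = mat (Suc i) (Suc i) (\<lambda>(a, b). if b < i then of_bool (a = b) else if a < i then S a else D i)"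
  define r where "r = mat 1 i (\<lambda>(a, b). - fps_X * fps_const (A i b))"
  have [simp]: "N \<in> carrier_mat (Suc i) (Suc i)" "T \<in> carrier_mat (Suc i) (Suc i)"
    by (auto simp: N_def T_def rev_char_mat_def)
  \<comment> \<open>The coefficient recursion of \<open>border_sol\<close>, read as a linear system
    for power series.\<close>
  have S: "S v = fps_X * (fps_const (A v i) * D i) + fps_X * (\<Sum>u<i. fps_const (A v u) * S u)" for v
  proof (rule fps_ext)
    fix d
    show "fps_nth (S v) d = fps_nth (fps_X * (fps_const (A v i) * D i) + fps_X * (\<Sum>u<i. fps_const (A v u) * S u)) d"
      by (cases d) (simp_all add: S_def D_def fps_sum_nth)
  qed
  have "N * T = four_block_mat (rev_char_mat A i) (0\<^sub>m i 1) r (mat 1 1 (\<lambda>_. new))" (is "_ = ?F")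
  proof (rule eq_matI)
    fix a b assume "a < dim_row ?F" "b < dim_col ?F"
    then have ab: "a < Suc i" "b < Suc i" by (auto simp: rev_char_mat_def r_def)
    have NT: "(N * T) $$ (a, b) = (\<Sum>u<i. N $$ (a, u) * T $$ (u, b)) + N $$ (a, i) * T $$ (i, b)"
      using ab by (simp add: scalar_prod_def atLeast0LessThan N_def T_def rev_char_mat_def)
    show "(N * T) $$ (a, b) = ?F $$ (a, b)"
    proof (cases "b < i")
      case True
      then have "(\<Sum>u<i. N $$ (a, u) * T $$ (u, b)) = (\<Sum>u<i. if u = b then N $$ (a, b) else 0)"
        by (intro sum.cong) (auto simp: T_def)
      then have "(N * T) $$ (a, b) = N $$ (a, b)" using True NT by (simp add: T_def)
      then show ?thesis using ab True by (auto simp: N_def rev_char_mat_def r_def less_Suc_eq)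
    next
      case False
      then have b: "b = i" using ab by simp
      have "(\<Sum>u<i. N $$ (a, u) * T $$ (u, b))
          = (\<Sum>u<i. of_bool (a = u) * S u) - fps_X * (\<Sum>u<i. fps_const (A a u) * S u)"
        using ab b by (simp add: N_def T_def rev_char_mat_def left_diff_distrib sum_subtractf
            sum_distrib_left mult.assoc)
      also have "(\<Sum>u<i. of_bool (a = u) * S u) = (if a < i then S a else 0)"
        by (simp add: of_bool_def if_distrib[of "\<lambda>x. x * _"] cong: if_cong)
      finally have s: "(\<Sum>u<i. N $$ (a, u) * T $$ (u, b))
          = (if a < i then S a else 0) - fps_X * (\<Sum>u<i. fps_const (A a u) * S u)" .
      show ?thesis
      proof (cases "a < i")
        case True
        then have "(N * T) $$ (a, b) = 0"
          unfolding NT s using S[of a] ab b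
          by (simp add: N_def T_def rev_char_mat_def algebra_simps)
        then show ?thesis using True b by (simp add: rev_char_mat_def)
      next
        case False
        then have a: "a = i" using ab by simp
        then have "(N * T) $$ (a, b) = new"
          unfolding NT s using b
          by (simp add: N_def T_def rev_char_mat_def new_def algebra_simps)
        then show ?thesis using a b by (simp add: rev_char_mat_def)
      qed
    qed
  qed (auto simp: N_def T_def rev_char_mat_def r_def)
  then have "det N * det T = D i * new"
    using det_mult[of N "Suc i" T]
      det_four_block_mat_upper_right_zero_col[of "rev_char_mat A i" i "0\<^sub>m i 1" r "mat 1 1 (\<lambda>_. new)"]
    by (simp add: D_def rev_char_mat_def r_def det_single)
  moreover have "det T = D i"
  proof -
    have "det T = prod_list (diag_mat T)"
      by (rule det_upper_triangular) (auto simp: T_def)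
    also have "\<dots> = (\<Prod>k<Suc i. T $$ (k, k))"
      by (simp add: diag_mat_def prod.distinct_set_conv_list[symmetric] T_def
          atLeast0LessThan del: upt_Suc)
    also have "\<dots> = D i" by (simp add: T_def)
    finally show ?thesis .
  qed
  ultimately have "D i * det N = D i * new" by (simp add: mult_ac)
  then have "det N = new" using fps_mult_left_cancel_unit D0 by blast
  then show ?thesis by (simp add: N_def D_def new_def S_def)
qed

text \<open>An induction interleaved with the recursion: the step to \<open>Suc i\<close> cancels a
  determinant whose constant term is already known to be 1.\<close>

lemma det_rev_char_mat_nth_0: "fps_nth (det (rev_char_mat A i)) 0 = 1"
proof (induction i)
  case (Suc i)
  then show ?case using det_rev_char_mat_Suc_aux[of A i] by simp
qed simp

lemma det_rev_char_mat_Suc_nth_Suc: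
  "fps_nth (det (rev_char_mat A (Suc i))) (Suc d)
     = fps_nth (det (rev_char_mat A i)) (Suc d) - A i i * fps_nth (det (rev_char_mat A i)) d
       - (\<Sum>v<i. A i v * border_sol A i d v)"
  by (subst det_rev_char_mat_Suc_aux[OF det_rev_char_mat_nth_0])
     (simp add: right_diff_distrib fps_sum_nth mult_ac)

lemma fps_nth_prod_linear:
  fixes a c :: "'i \<Rightarrow> 'r::comm_ring_1"
  assumes "finite I"
  shows "fps_nth (\<Prod>i\<in>I. fps_const (c i) + fps_X * fps_const (a i)) (card I) = (\<Prod>i\<in>I. a i)
    \<and> (\<forall>k>card I. fps_nth (\<Prod>i\<in>I. fps_const (c i) + fps_X * fps_const (a i)) k = 0)"
  using assms
proof (induction I rule: finite_induct)
  case (insert x F)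
  then show ?case
    by (auto simp: distrib_right mult.assoc fps_X_mult_nth)
qed simp

text \<open>All entries have degree at most one in \<open>fps_X\<close>, so in each Leibniz product
  the coefficient at degree \<open>m\<close> takes the linear part \<open>- A i (p i)\<close> of
  every factor.\<close>

lemma det_eq_coeff_rev_char_mat:
  "fps_nth (det (rev_char_mat A m)) m = (- 1) ^ m * det (mat m m (\<lambda>(i, j). A i j))"
proof -
  let ?P = "{p. p permutes {0..<m}}"
  have c: "fps_nth (\<Prod>i = 0..<m. rev_char_mat A m $$ (i, p i)) m = (\<Prod>i = 0..<m. - A i (p i))"
    if "p \<in> ?P" for p
  proof -
    have "(\<Prod>i = 0..<m. rev_char_mat A m $$ (i, p i))
      = (\<Prod>i = 0..<m. fps_const (of_bool (i = p i)) + fps_X * fps_const (- A i (p i)))"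
      using that permutes_in_image[of p "{0..<m}"]
      by (intro prod.cong) (auto simp: rev_char_mat_def simp flip: fps_const_neg)
    then show ?thesis
      using fps_nth_prod_linear[of "{0..<m}" "\<lambda>i. of_bool (i = p i)" "\<lambda>i. - A i (p i)"] by simp
  qed
  have s: "signof p = fps_const (signof p)" for p :: "nat \<Rightarrow> nat"
    by (cases "sign p = 1") (auto simp: sign_def simp flip: fps_const_neg)
  have "fps_nth (det (rev_char_mat A m)) m
      = (\<Sum>p\<in>?P. fps_nth (signof p * (\<Prod>i = 0..<m. rev_char_mat A m $$ (i, p i))) m)"
    by (subst det_def'[of _ m]) (auto simp: rev_char_mat_def fps_sum_nth)
  also have "\<dots> = (\<Sum>p\<in>?P. signof p * (\<Prod>i = 0..<m. - A i (p i)))"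
    by (intro sum.cong refl) (subst s, simp add: c)
  also have "\<dots> = (\<Sum>p\<in>?P. (- 1) ^ m * (signof p * (\<Prod>i = 0..<m. A i (p i))))"
    by (intro sum.cong refl) (simp add: prod_uminus mult_ac)
  also have "\<dots> = (- 1) ^ m * det (mat m m (\<lambda>(i, j). A i j))"
  proof -
    have "(\<Prod>i = 0..<m. A i (p i)) = (\<Prod>i = 0..<m. mat m m (\<lambda>(i, j). A i j) $$ (i, p i))"
      if "p \<in> ?P" for p
      using that permutes_in_image[of p "{0..<m}"] by (intro prod.cong) auto
    then show ?thesis
      by (subst det_def'[of _ m]) (auto simp: sum_distrib_left)
  qed
  finally show ?thesis .
qed

subsection \<open>Affine forms\<close>

definition affine_forms :: "'v set \<Rightarrow> ('v, 'c::comm_ring_1) mpoly set" where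
  "affine_forms V = {q. \<exists>c0 c. q = mconst c0 + (\<Sum>v\<in>V. mconst (c v) * mvar v)}"

lemma affine_mconst: "mconst c \<in> affine_forms V"
  unfolding affine_forms_def by (auto intro!: exI[of _ c] exI[of _ "\<lambda>_. 0"])

lemma affine_0: "0 \<in> affine_forms V" and affine_1: "1 \<in> affine_forms V"
  using affine_mconst[of 0 V] affine_mconst[of 1 V] by auto

lemma affine_mvar:
  assumes "finite V" "v \<in> V"
  shows "(mvar v :: ('v, 'c::comm_ring_1) mpoly) \<in> affine_forms V"
  unfolding affine_forms_def
  using assms by (auto intro!: exI[of _ 0] exI[of _ "\<lambda>u. if u = v then 1 else 0"]
      simp: if_distrib[of mconst] if_distrib[of "\<lambda>x. x * _"] cong: if_cong)

lemma affine_add: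
  assumes "p \<in> affine_forms V" "q \<in> affine_forms V"
  shows "p + q \<in> affine_forms V"
proof -
  obtain c0 c d0 d where "p = mconst c0 + (\<Sum>v\<in>V. mconst (c v) * mvar v)"
    "q = mconst d0 + (\<Sum>v\<in>V. mconst (d v) * mvar v)"
    using assms by (auto simp: affine_forms_def)
  then have "p + q = mconst (c0 + d0) + (\<Sum>v\<in>V. mconst (c v + d v) * mvar v)"
    by (simp add: mconst_add distrib_right sum.distrib algebra_simps)
  then show ?thesis unfolding affine_forms_def by (intro CollectI exI)
qed

lemma affine_scale:
  assumes "p \<in> affine_forms V"
  shows "mconst c * p \<in> affine_forms V"
proof -
  obtain c0 d where "p = mconst c0 + (\<Sum>v\<in>V. mconst (d v) * mvar v)"
    using assms by (auto simp: affine_forms_def)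
  then have "mconst c * p = mconst (c * c0) + (\<Sum>v\<in>V. mconst (c * d v) * mvar v)"
    by (simp add: mconst_mult distrib_left sum_distrib_left mult.assoc)
  then show ?thesis unfolding affine_forms_def by (intro CollectI exI)
qed

lemma affine_uminus: "p \<in> affine_forms V \<Longrightarrow> - p \<in> affine_forms V"
  using affine_scale[of p V "- 1"] by (simp add: mconst_hom.hom_uminus)

lemma affine_sum:
  "(\<And>i. i \<in> A \<Longrightarrow> f i \<in> affine_forms V) \<Longrightarrow> (\<Sum>i\<in>A. f i) \<in> affine_forms V"
  by (induction A rule: infinite_finite_induct) (auto intro: affine_add affine_0)

text \<open>Each variable adds four nodes: itself, its coefficient, a product and a sum.\<close>

lemma affine_formula:
  assumes "finite V" "q \<in> affine_forms V"
  shows "\<exists>\<Psi>. formula_poly \<Psi> = q \<and> formula_vars \<Psi> \<subseteq> V \<and> formula_size \<Psi> \<le> 1 + 4 * card V"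
proof -
  obtain c0 c where q: "q = mconst c0 + (\<Sum>v\<in>V. mconst (c v) * mvar v)"
    using assms by (auto simp: affine_forms_def)
  have "\<exists>\<Psi>. formula_poly \<Psi> = mconst c0 + (\<Sum>v\<in>V. mconst (c v) * mvar v) \<and>
      formula_vars \<Psi> \<subseteq> V \<and> formula_size \<Psi> \<le> 1 + 4 * card V"
    using assms(1)
  proof (induction V rule: finite_induct)
    case empty
    then show ?case by (intro exI[of _ "FConst c0"]) auto
  next
    case (insert x F)
    then obtain \<Psi> where "formula_poly \<Psi> = mconst c0 + (\<Sum>v\<in>F. mconst (c v) * mvar v)"
      "formula_vars \<Psi> \<subseteq> F" "formula_size \<Psi> \<le> 1 + 4 * card F" by auto
    then show ?case using insert
      by (intro exI[of _ "FAdd (FMul (FConst (c x)) (FVar x)) \<Psi>"]) (auto simp: algebra_simps)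
  qed
  then show ?thesis using q by simp
qed

subsection \<open>A branching program for the determinant\<close>

text \<open>The equation of one vertex of a branching program: its incoming edges carry affine
  labels and start at smaller indices, so the numbering is a topological order. Integral labels keep
  later remainders of the form O(\<epsilon>).\<close>

definition abp_combination ::
    "'v set \<Rightarrow> (nat \<Rightarrow> ('v, 'a::field fls) mpoly) \<Rightarrow> nat \<Rightarrow> ('v, 'a fls) mpoly \<Rightarrow> bool" where
  "abp_combination V p k x \<longleftrightarrow>
     (\<exists>a. (\<forall>j. a j \<in> affine_forms V \<inter> integral_mpoly V) \<and> x = (\<Sum>j<k. a j * p j))"

lemma abp_0: "abp_combination V p k 0"
  unfolding abp_combination_def by (intro exI[of _ "\<lambda>_. 0"]) (auto intro: affine_0 integral)

lemma abp_add:
  assumes "abp_combination V p k x" "abp_combination V p k y"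
  shows "abp_combination V p k (x + y)"
proof -
  obtain a b where "\<forall>j. a j \<in> affine_forms V \<inter> integral_mpoly V" "x = (\<Sum>j<k. a j * p j)"
    "\<forall>j. b j \<in> affine_forms V \<inter> integral_mpoly V" "y = (\<Sum>j<k. b j * p j)"
    using assms unfolding abp_combination_def by blast
  then show ?thesis unfolding abp_combination_def
    by (intro exI[of _ "\<lambda>j. a j + b j"])
       (auto intro: affine_add integral simp: distrib_right sum.distrib)
qed

lemma abp_uminus:
  assumes "abp_combination V p k x"
  shows "abp_combination V p k (- x)"
proof -
  obtain a where "\<forall>j. a j \<in> affine_forms V \<inter> integral_mpoly V" "x = (\<Sum>j<k. a j * p j)"
    using assms unfolding abp_combination_def by blast
  then show ?thesis unfolding abp_combination_def
    by (intro exI[of _ "\<lambda>j. - a j"]) (auto intro: affine_uminus integral simp: sum_negf)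
qed

lemma abp_diff:
  "abp_combination V p k x \<Longrightarrow> abp_combination V p k y \<Longrightarrow> abp_combination V p k (x - y)"
  using abp_add[OF _ abp_uminus, of V p k x y] by simp

lemma abp_sum:
  "(\<And>i. i \<in> A \<Longrightarrow> abp_combination V p k (f i)) \<Longrightarrow> abp_combination V p k (\<Sum>i\<in>A. f i)"
  by (induction A rule: infinite_finite_induct) (auto intro: abp_add abp_0)

lemma abp_mult:
  assumes "j < k" "c \<in> affine_forms V" "c \<in> integral_mpoly V"
  shows "abp_combination V p k (c * p j)"
  unfolding abp_combination_def using assms
  by (intro exI[of _ "\<lambda>i. if i = j then c else 0"])
     (auto intro: affine_0 integral simp: if_distrib[of "\<lambda>x. x * _"] cong: if_cong)

lemma abp_cong:
  assumes "abp_combination V p k x" "\<And>j. j < k \<Longrightarrow> p j = p' j"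
  shows "abp_combination V p' k x"
  using assms unfolding abp_combination_def by auto

context
  fixes m :: nat and A :: "nat \<Rightarrow> nat \<Rightarrow> (nat \<times> nat, 'a::field fls) mpoly" and V
  defines "A \<equiv> \<lambda>i j. mvar (i, j)" and "V \<equiv> {..<m} \<times> {..<m}"
begin

text \<open>Last digit 0 marks a coefficient of a reversed characteristic polynomial, last digit
  \<open>Suc u\<close> an auxiliary \<open>border_sol\<close>. The guard \<open>i < m\<close>
  excludes values that would mention the variable column \<open>m\<close>, which lies outside
  \<open>V\<close>.\<close>

definition node_value :: "nat \<Rightarrow> nat \<Rightarrow> nat \<Rightarrow> (nat \<times> nat, 'a fls) mpoly" where
  "node_value i d v = (case v of 0 \<Rightarrow> fps_nth (det (rev_char_mat A i)) d
     | Suc u \<Rightarrow> if u < i \<and> i < m then border_sol A i d u else 0)"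

text \<open>Vertices are triples of digits in base \<open>m + 1\<close>, most significant digit first.\<close>

definition vertex_value :: "nat \<Rightarrow> (nat \<times> nat, 'a fls) mpoly" where
  "vertex_value k = node_value (k div (Suc m * Suc m)) (k div Suc m mod Suc m) (k mod Suc m)"

abbreviation vertex :: "nat \<Rightarrow> nat \<Rightarrow> nat \<Rightarrow> nat" where
  "vertex i d v \<equiv> (i * Suc m + d) * Suc m + v"

lemma vertex_value_vertex:
  assumes "d \<le> m" "v \<le> m"
  shows "vertex_value (vertex i d v) = node_value i d v"
proof -
  have "(a * M + b) div M = a \<and> (a * M + b) mod M = b" if "b < M" for a b M :: nat
    using that by simp
  note digits = conjunct1[OF this] conjunct2[OF this]
  have "d < Suc m" "v < Suc m" using assms by auto
  note digits = digits[OF this(1)] digits[OF this(2)]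
  show ?thesis unfolding vertex_value_def div_mult2_eq digits ..
qed

text \<open>The recursions lead from layer \<open>i'\<close> to \<open>Suc i'\<close>, or inside a
  layer from degree \<open>d'\<close> to \<open>Suc d'\<close>; both raise the vertex number.
  Subtracting \<open>of_bool\<close> singles out the source, vertex 0, which has value 1 and no
  incoming edge.\<close>

lemma abp_vertex_aux:
  assumes "i \<le> m" "d \<le> m" "v \<le> m"
  shows "abp_combination V vertex_value (vertex i d v) (node_value i d v - of_bool (vertex i d v = 0))"
proof -
  have fin: "finite V" by (simp add: V_def)
  have A: "A a b \<in> affine_forms V" "A a b \<in> integral_mpoly V" if "a < m" "b < m" for a b
    using that fin by (auto simp: A_def V_def intro!: affine_mvar integral)
  have node: "abp_combination V vertex_value k (c * node_value i' d' v')"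
    if "vertex i' d' v' < k" "d' \<le> m" "v' \<le> m" "c \<in> affine_forms V" "c \<in> integral_mpoly V"
    for i' d' v' c k
    using abp_mult[OF that(1,4,5), of vertex_value] unfolding vertex_value_vertex[OF that(2,3)] .
  have node1: "abp_combination V vertex_value k (node_value i' d' v')"
    if "vertex i' d' v' < k" "d' \<le> m" "v' \<le> m" for i' d' v' k
    using node[OF that affine_1 integral_1] by simp
  have less1: "vertex i' d' v' < vertex (Suc i') d'' v''" if "d' \<le> m" "v' \<le> m" for i' d' v' d'' v''
  proof -
    have "i' * Suc m + d' < Suc i' * Suc m + d''" using that by simp
    then have "(i' * Suc m + d' + 1) * Suc m \<le> (Suc i' * Suc m + d'') * Suc m"
      by (intro mult_right_mono) auto
    then show ?thesis using that by simp
  qed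
  have less2: "vertex i' d' v' < vertex i' (Suc d') v''" if "v' \<le> m" for i' d' v' v''
    using that by simp
  show ?thesis
  proof (cases v)
    case 0
    show ?thesis
    proof (cases i)
      case i0: 0
      have "node_value i d v - of_bool (vertex i d v = 0) = 0"
        by (simp add: 0 i0 node_value_def)
      then show ?thesis by (simp only: abp_0)
    next
      case (Suc i')
      have nz: "vertex i d v \<noteq> 0" by (simp add: Suc)
      show ?thesis
      proof (cases d)
        case d0: 0
        have "node_value i d v = node_value i' 0 0"
          by (simp add: node_value_def 0 Suc d0 det_rev_char_mat_nth_0)
        moreover have "abp_combination V vertex_value (vertex i d v) \<dots>"
          unfolding Suc by (intro node1 less1) auto
        ultimately show ?thesis by (simp only: nz of_bool_eq diff_0_right)
      next
        case d: (Suc d')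
        have "node_value i d v = node_value i' d 0 - A i' i' * node_value i' d' 0
            - (\<Sum>u<i'. A i' u * node_value i' d' (Suc u))"
          using assms Suc by (simp add: node_value_def 0 d det_rev_char_mat_Suc_nth_Suc)
        moreover have "abp_combination V vertex_value (vertex i d v) \<dots>"
          unfolding Suc using assms Suc d
          by (intro abp_diff abp_sum node node1 A less1) auto
        ultimately show ?thesis by (simp only: nz of_bool_eq diff_0_right)
      qed
    qed
  next
    case (Suc v')
    have nz: "vertex i d v \<noteq> 0" by (simp add: Suc)
    show ?thesis
    proof (cases "v' < i \<and> i < m \<and> d \<noteq> 0")
      case True
      then obtain d' where d: "d = Suc d'" by (cases d) auto
      have "node_value i d v = A v' i * node_value i d' 0 + (\<Sum>u<i. A v' u * node_value i d' (Suc u))"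
        using True by (simp add: node_value_def Suc d)
      moreover have "abp_combination V vertex_value (vertex i d v) \<dots>"
        unfolding d using assms True d
        by (intro abp_add abp_sum node A less2) auto
      ultimately show ?thesis by (simp only: nz of_bool_eq diff_0_right)
    next
      case False
      then have "node_value i d v = 0" by (auto simp: node_value_def Suc)
      then show ?thesis by (simp only: nz of_bool_eq diff_0_right abp_0)
    qed
  qed
qed

lemma abp_vertex:
  assumes "k < Suc m ^ 3"
  shows "abp_combination V vertex_value k (vertex_value k - of_bool (k = 0))"
proof -
  define i d v where idv: "i = k div (Suc m * Suc m)" "d = k div Suc m mod Suc m" "v = k mod Suc m"
  have "i < Suc m" using assms unfolding idv
    by (subst div_less_iff_less_mult) (auto simp: power3_eq_cube algebra_simps)
  moreover have "d < Suc m" "v < Suc m" unfolding idv by (auto intro!: mod_less_divisor)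
  ultimately have le: "i \<le> m" "d \<le> m" "v \<le> m" by (simp_all only: less_Suc_eq_le)
  have k: "k = vertex i d v"
    unfolding idv div_mult2_eq by (simp only: div_mult_mod_eq)
  show ?thesis
    using abp_vertex_aux[OF le] unfolding vertex_value_vertex[OF le(2,3), symmetric] k[symmetric] .
qed

text \<open>The sink has to sit exactly at \<open>N\<close>, because the pivot position will be
  dictated by a monomial of \<open>diag_poly\<close>. The program is padded with zero vertices, and
  an edge of weight 1 copies the output \<open>?f\<close> to \<open>N\<close> unless they
  coincide.\<close>

lemma det_abp:
  assumes N: "Suc m ^ 3 \<le> Suc N"
  shows "\<exists>(p :: nat \<Rightarrow> (nat \<times> nat, 'a fls) mpoly) a. (\<forall>j k. a j k \<in> affine_forms V \<inter> integral_mpoly V) \<and>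
     (\<forall>k\<le>N. p k = of_bool (k = 0) + (\<Sum>j<k. a j k * p j)) \<and>
     p N = (- 1) ^ m * det (var_mat m Pair)"
proof -
  let ?f = "vertex m m 0"
  have "(m * Suc m + m) * Suc m + Suc m = Suc m ^ 3" by (simp add: power3_eq_cube algebra_simps)
  then have f: "?f < Suc m ^ 3" "?f \<le> N" "?f < N \<Longrightarrow> N \<noteq> 0" using N by linarith+
  \<comment> \<open>If \<open>N\<close> is itself a vertex number of the program, that vertex is
    overwritten. Vertices up to \<open>N\<close> depend only on smaller ones, so no value in use is
    lost.\<close>
  define p where "p = (\<lambda>k. if k = N then vertex_value ?f else if k < Suc m ^ 3 then vertex_value k else 0)"
  have p: "abp_combination V p k (p k - of_bool (k = 0))" if k: "k \<le> N" for k
  proof -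
    have pe: "p j = vertex_value j" if "j < k" "k < Suc m ^ 3" for j
      using that k by (auto simp: p_def)
    consider "k = N" "?f = N" | "k = N" "?f < N" | "k < N" "k < Suc m ^ 3" | "k < N" "Suc m ^ 3 \<le> k"
      using k f by linarith
    then show ?thesis
    proof cases
      case 1
      then have k': "k < Suc m ^ 3" "p k = vertex_value k" using f by (auto simp: p_def)
      show ?thesis using abp_cong[OF abp_vertex[OF k'(1)], of p] pe k' by simp
    next
      case 2
      then have "p k = 1 * p ?f" "k \<noteq> 0" using f by (auto simp: p_def)
      then show ?thesis using 2 abp_mult[OF _ affine_1 integral_1, of ?f k V p] by simp
    next
      case 3
      then have k': "p k = vertex_value k" by (auto simp: p_def)
      show ?thesis using abp_cong[OF abp_vertex[OF 3(2)], of p] pe k' 3 by simp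
    next
      case 4
      have "0 < Suc m ^ 3" by (rule zero_less_power) simp
      then have "k \<noteq> 0" using 4(2) by linarith
      moreover have "p k = 0" using 4 by (auto simp: p_def)
      ultimately have "p k = 0" "k \<noteq> 0" by auto
      then show ?thesis by (simp add: abp_0)
    qed
  qed
  then have "\<forall>k. \<exists>a. k \<le> N \<longrightarrow> (\<forall>j. a j \<in> affine_forms V \<inter> integral_mpoly V)
      \<and> p k - of_bool (k = 0) = (\<Sum>j<k. a j * p j)"
    unfolding abp_combination_def by blast
  from choice[OF this] obtain a where a: "\<And>k. k \<le> N \<Longrightarrow>
      (\<forall>j. a k j \<in> affine_forms V \<inter> integral_mpoly V) \<and>
      p k - of_bool (k = 0) = (\<Sum>j<k. a k j * p j)"
    by blast
  let ?a = "\<lambda>j k. if k \<le> N then a k j else 0"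
  have "p N = node_value m m 0" using vertex_value_vertex[of m 0 m] by (simp add: p_def)
  also have "\<dots> = (- 1) ^ m * det (var_mat m Pair)"
    by (simp add: node_value_def det_eq_coeff_rev_char_mat A_def var_mat_def)
  finally have "p N = (- 1) ^ m * det (var_mat m Pair)" .
  moreover have "\<forall>k\<le>N. p k = of_bool (k = 0) + (\<Sum>j<k. ?a j k * p j)"
    using a by (auto simp: algebra_simps)
  moreover have "\<forall>j k. ?a j k \<in> affine_forms V \<inter> integral_mpoly V"
    using a affine_0 integral_0 by auto
  ultimately show ?thesis by - (rule exI[of _ p], rule exI[of _ ?a], intro conjI)
qed

end

subsection \<open>Triangular factorisation of the branching program matrix\<close>

text \<open>\<open>U\<close> is the identity minus the edge matrix, and the recurrence says that the
  row \<open>p\<close> times \<open>U\<close> is the first unit vector. Row \<open>N\<close> of the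
  product is therefore row \<open>N\<close> of \<open>U\<close> plus \<open>c\<close> times that
  unit vector. So \<open>X\<close> is affine although \<open>L\<close> and the pivot contain the
  nonlinear values \<open>p j\<close>.\<close>

lemma abp_matrix_factorization:
  fixes p :: "nat \<Rightarrow> ('v, 'a::field fls) mpoly"
  assumes N: "N < n" and a: "\<And>j k. a j k \<in> affine_forms V \<inter> integral_mpoly V"
    and p: "\<And>k. k \<le> N \<Longrightarrow> p k = of_bool (k = 0) + (\<Sum>j<k. a j k * p j)"
    and c: "c \<in> range fps_to_fls"
  shows "\<exists>L U X. (\<forall>i j. L i j \<in> integral_mpoly V) \<and> (\<forall>i j. i \<le> j \<longrightarrow> L i j = of_bool (i = j)) \<and>
    (\<forall>i j. U i j \<in> integral_mpoly V) \<and> (\<forall>i j. j \<le> i \<longrightarrow> U i j = of_bool (i = j)) \<and>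
    (\<forall>i j. X i j \<in> affine_forms V) \<and>
    (\<forall>i j. i < n \<longrightarrow> j < n \<longrightarrow>
       (\<Sum>k<n. L i k * (if k = N then 1 + mconst c * p N else 1) * U k j) = X i j) \<and>
    p N \<in> integral_mpoly V"
proof -
  have int_p: "p k \<in> integral_mpoly V" if "k \<le> N" for k
    using that
  proof (induction k rule: less_induct)
    case (less k)
    have "of_bool (k = 0) + (\<Sum>j<k. a j k * p j) \<in> integral_mpoly V"
      using a less by (intro integral) (auto intro: integral)
    then show ?case using p less by simp
  qed
  define L where "L = (\<lambda>i j. if i = j then 1 else if i = N \<and> j < N then mconst c * p j else 0)"
  define U where "U = (\<lambda>i j. if i = j then 1 else if i < j \<and> j \<le> N then - a i j else 0)"
  define X where "X = (\<lambda>i j. U i j + (if i = N \<and> j = 0 then mconst c else 0))"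
  define d where "d = (\<lambda>k. if k = N then 1 + mconst c * p N else 1)"
  have pU: "(\<Sum>k\<le>N. p k * U k j) = of_bool (j = 0)" for j
  proof (cases "j \<le> N")
    case True
    have "(\<Sum>k\<le>N. p k * U k j) = (\<Sum>k\<le>j. p k * U k j)"
      using True by (intro sum.mono_neutral_right) (auto simp: U_def)
    also have "\<dots> = (\<Sum>k<j. p k * U k j) + p j * U j j"
      by (simp add: lessThan_Suc_atMost[symmetric])
    also have "(\<Sum>k<j. p k * U k j) = - (\<Sum>k<j. a k j * p k)"
      using True by (simp add: U_def sum_negf mult.commute)
    finally show ?thesis using p[OF True] by (simp add: U_def)
  next
    case False
    then show ?thesis by (auto simp: U_def intro!: sum.neutral)
  qed
  have fac: "(\<Sum>k<n. L i k * d k * U k j) = X i j" if "i < n" "j < n" for i j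
  proof (cases "i = N")
    case True
    have "(\<Sum>k<n. L i k * d k * U k j) = (\<Sum>k\<le>N. L i k * d k * U k j)"
      using N True by (intro sum.mono_neutral_right) (auto simp: L_def)
    also have "\<dots> = (\<Sum>k<N. L N k * d k * U k j) + d N * U N j"
      by (simp add: lessThan_Suc_atMost[symmetric] True L_def)
    also have "(\<Sum>k<N. L N k * d k * U k j) = mconst c * (\<Sum>k<N. p k * U k j)"
      by (simp add: L_def d_def sum_distrib_left mult.assoc)
    also have "\<dots> + d N * U N j = U N j + mconst c * (\<Sum>k\<le>N. p k * U k j)"
      by (simp add: lessThan_Suc_atMost[symmetric] d_def algebra_simps)
    finally show ?thesis unfolding pU using True by (simp add: X_def)
  next
    case False
    have "(\<Sum>k<n. L i k * d k * U k j) = (\<Sum>k\<in>{i}. L i k * d k * U k j)"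
      using False that by (intro sum.mono_neutral_right) (auto simp: L_def)
    then show ?thesis using False by (simp add: L_def d_def X_def)
  qed
  show ?thesis
  proof (rule exI[of _ L], rule exI[of _ U], rule exI[of _ X], intro conjI allI impI)
    show "L i j \<in> integral_mpoly V" for i j
      using int_p integral_mconst[OF c] by (auto simp: L_def intro!: integral)
    show "U i j \<in> integral_mpoly V" for i j using a by (auto simp: U_def intro!: integral)
    show "X i j \<in> affine_forms V" for i j
      using a by (auto simp: X_def U_def intro!: affine_add affine_mconst affine_uminus affine_0 affine_1)
    show "p N \<in> integral_mpoly V" by (rule int_p) simp
    show "i < n \<Longrightarrow> j < n \<Longrightarrow>
       (\<Sum>k<n. L i k * (if k = N then 1 + mconst c * p N else 1) * U k j) = X i j" for i j
      using fac[of i j] by (simp add: d_def)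
  qed (auto simp: L_def U_def)
qed

text \<open>Conjugation by the torus element with entries \<open>\<epsilon>\<^sup>w\<close> moves both unipotent factors towards the
  identity.\<close>

lemma scaled_factorization:
  fixes L U X :: "nat \<Rightarrow> nat \<Rightarrow> ('v, 'a::field fls) mpoly" and E
  defines "E \<equiv> mconst fls_X"
  assumes L: "\<And>i j. L i j \<in> integral_mpoly V" "\<And>i j. i \<le> j \<Longrightarrow> L i j = of_bool (i = j)"
    and U: "\<And>i j. U i j \<in> integral_mpoly V" "\<And>i j. j \<le> i \<Longrightarrow> U i j = of_bool (i = j)"
    and X: "\<And>i j. i < n \<Longrightarrow> j < n \<Longrightarrow> (\<Sum>k<n. L i k * d k * U k j) = X i j"
    and w: "\<And>i j. i < j \<Longrightarrow> w i + G \<le> w j"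
  shows "\<exists>P Q. (\<forall>i j. P i j \<in> integral_mpoly V) \<and> (\<forall>i j. Q i j \<in> integral_mpoly V) \<and>
    (\<forall>i j. i < n \<longrightarrow> j < n \<longrightarrow>
      (\<Sum>k<n. (of_bool (i = k) + E ^ G * P i k) * (E ^ (2 * w k) * d k) * (of_bool (k = j) + E ^ G * Q k j))
        = E ^ (w i + w j) * X i j)"
proof -
  \<comment> \<open>By \<open>w\<close> the truncated exponents are exact: conjugation contributes
    \<epsilon>^(w i - w k), from which \<epsilon>^G is split off.\<close>
  define P where "P = (\<lambda>i k. if k < i then E ^ (w i - w k - G) * L i k else 0)"
  define Q where "Q = (\<lambda>k j. if k < j then E ^ (w j - w k - G) * U k j else 0)"
  have int_P: "P i j \<in> integral_mpoly V" for i j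
    using L(1) by (auto simp: P_def E_def intro!: integral)
  have int_Q: "Q i j \<in> integral_mpoly V" for i j
    using U(1) by (auto simp: Q_def E_def intro!: integral)
  have P: "(of_bool (i = k) + E ^ G * P i k) * E ^ w k = E ^ w i * L i k" for i k
  proof (cases "k < i")
    case True
    have "G + (w i - w k - G) + w k = w i" using w[OF True] by simp
    then have "E ^ G * E ^ (w i - w k - G) * E ^ w k = E ^ w i" by (simp flip: power_add)
    then show ?thesis using True by (simp add: P_def mult_ac)
  qed (use L(2)[of i k] in \<open>auto simp: P_def\<close>)
  have Q: "E ^ w k * (of_bool (k = j) + E ^ G * Q k j) = E ^ w j * U k j" for k j
  proof (cases "k < j")
    case True
    have "G + (w j - w k - G) + w k = w j" using w[OF True] by simp
    then have "E ^ G * E ^ (w j - w k - G) * E ^ w k = E ^ w j" by (simp flip: power_add)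
    moreover have "E ^ w k * (E ^ G * (E ^ (w j - w k - G) * U k j)) = E ^ G * E ^ (w j - w k - G) * E ^ w k * U k j"
      by (simp only: mult_ac)
    ultimately show ?thesis using True by (simp add: Q_def)
  qed (use U(2)[of j k] in \<open>auto simp: Q_def\<close>)
  have "(\<Sum>k<n. (of_bool (i = k) + E ^ G * P i k) * (E ^ (2 * w k) * d k) * (of_bool (k = j) + E ^ G * Q k j))
        = E ^ (w i + w j) * X i j" if "i < n" "j < n" for i j
  proof -
    have "(of_bool (i = k) + E ^ G * P i k) * (E ^ (2 * w k) * d k) * (of_bool (k = j) + E ^ G * Q k j)
      = E ^ (w i + w j) * (L i k * d k * U k j)" for k
    proof -
      have "(of_bool (i = k) + E ^ G * P i k) * (E ^ (2 * w k) * d k) * (of_bool (k = j) + E ^ G * Q k j)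
        = ((of_bool (i = k) + E ^ G * P i k) * E ^ w k) * d k * (E ^ w k * (of_bool (k = j) + E ^ G * Q k j))"
        unfolding mult_2 power_add by (simp only: mult_ac)
      also have "\<dots> = E ^ (w i + w j) * (L i k * d k * U k j)"
        unfolding P Q by (simp only: power_add mult_ac)
      finally show ?thesis .
    qed
    then show ?thesis using X[OF that] by (simp flip: sum_distrib_left)
  qed
  then show ?thesis using int_P int_Q by blast
qed

subsection \<open>Separating weights\<close>

text \<open>The difference of two weighted sums is the value at \<open>K\<close> of the integer
  polynomial \<open>D f g\<close>, whose coefficients are the differences \<open>f v - g v\<close>
  since \<open>c\<close> is injective on \<open>V\<close>. Finitely many nonzero polynomials have
  finitely many roots, so some \<open>K\<close> avoids them all.\<close>

lemma separating_weights:
  fixes c :: "'v \<Rightarrow> nat" and M :: "('v \<Rightarrow> nat) set"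
  assumes V: "finite V" "inj_on c V" and M: "finite M"
  obtains K where "2 \<le> K"
    "\<And>f g v. f \<in> M \<Longrightarrow> g \<in> M \<Longrightarrow> (\<Sum>v\<in>V. f v * K ^ c v) = (\<Sum>v\<in>V. g v * K ^ c v) \<Longrightarrow> v \<in> V \<Longrightarrow> f v = g v"
proof -
  define D where "D = (\<lambda>f g. \<Sum>v\<in>V. Polynomial.monom (int (f v) - int (g v)) (c v))"
  have coeff: "poly.coeff (D f g) (c v) = int (f v) - int (g v)" if "v \<in> V" for f g v
  proof -
    have "poly.coeff (D f g) (c v) = (\<Sum>u\<in>V. if u = v then int (f v) - int (g v) else 0)"
      unfolding D_def coeff_sum
      by (intro sum.cong refl) (use V(2) that in \<open>auto simp: inj_on_eq_iff\<close>)
    then show ?thesis using V(1) that by simp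
  qed
  have poly: "poly (D f g) (int K) = int (\<Sum>v\<in>V. f v * K ^ c v) - int (\<Sum>v\<in>V. g v * K ^ c v)" for f g K
    by (simp add: D_def poly_sum poly_monom left_diff_distrib sum_subtractf)
  define B where "B = (\<Union>f\<in>M. \<Union>g\<in>{g\<in>M. D f g \<noteq> 0}. {x. poly (D f g) x = 0})"
  have "finite B" unfolding B_def using M by (intro finite_UN_I) (auto intro: poly_roots_finite)
  then have "finite (int -` B)" by (intro finite_vimageI) auto
  then have "infinite (UNIV - (int -` B \<union> {0, 1}))" by simp
  then have "UNIV - (int -` B \<union> {0, 1}) \<noteq> {}" by (rule infinite_imp_nonempty)
  then obtain K where K: "K \<notin> int -` B" "K \<noteq> 0" "K \<noteq> 1" by blast
  show thesis
  proof (rule that[of K])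
    fix f g v assume fg: "f \<in> M" "g \<in> M" "(\<Sum>v\<in>V. f v * K ^ c v) = (\<Sum>v\<in>V. g v * K ^ c v)" "v \<in> V"
    then have "poly (D f g) (int K) = 0" by (simp only: poly)
    then have "D f g = 0" using K(1) fg by (auto simp: B_def)
    then show "f v = g v" using coeff[OF fg(4), of f g] by simp
  qed (use K in simp)
qed

subsection \<open>Binomial expansions\<close>

lemma integral_binomial:
  assumes y: "y \<in> integral_mpoly V"
  shows "\<exists>u\<in>integral_mpoly V. (1 + y) ^ k = 1 + of_nat k * y + y\<^sup>2 * u"
proof (induction k)
  case 0
  show ?case by (rule bexI[of _ 0]) (auto intro: integral)
next
  case (Suc k)
  then obtain u where u: "u \<in> integral_mpoly V" "(1 + y) ^ k = 1 + of_nat k * y + y\<^sup>2 * u" by blast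
  have "(1 + y) ^ Suc k = 1 + of_nat (Suc k) * y + y\<^sup>2 * (u + of_nat k + y * u)"
    by (simp add: u(2) algebra_simps power2_eq_square)
  moreover have "u + of_nat k + y * u \<in> integral_mpoly V" using u y by (intro integral)
  ultimately show ?case by blast
qed

lemma of_nat_mpoly: "(of_nat k :: ('v, 'a::comm_ring_1 fls) mpoly) = mconst (fls_const (of_nat k))"
  by (simp add: mconst_hom.hom_of_nat flip: fls_of_nat)

lemma mconst_eq_0_iff [simp]: "mconst c = 0 \<longleftrightarrow> c = 0"
  by (metis lookup_single_eq lookup_zero mconst_0 mconst_def)

lemma CHAR_mpoly_fls: "CHAR(('v, 'a::field fls) mpoly) = CHAR('a)"
proof (rule CHAR_eqI)
  have z: "(of_nat k :: ('v, 'a fls) mpoly) = 0 \<longleftrightarrow> (of_nat k :: 'a) = 0" for k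
    unfolding of_nat_mpoly by simp
  show "of_nat CHAR('a) = (0 :: ('v, 'a fls) mpoly)" by (simp only: z of_nat_CHAR)
  show "CHAR('a) dvd k" if "of_nat k = (0 :: ('v, 'a fls) mpoly)" for k
    using that by (simp only: z of_nat_eq_0_iff_char_dvd)
qed

text \<open>In positive characteristic \<open>P\<close> is the full power of the characteristic
  dividing \<open>e\<close>. Then (1 + x)^e = (1 + x^P)^e', whose coefficient at x^P is the nonzero
  scalar \<open>e'\<close>.\<close>

lemma frobenius_factor:
  assumes e: "0 < e"
  obtains P e' where "e = P * e'" "0 < P" "(of_nat e' :: 'a::field) \<noteq> 0"
    "CHAR('a) = 0 \<Longrightarrow> P = 1" "CHAR('a) > 0 \<Longrightarrow> \<exists>k. P = CHAR('a) ^ k"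
    "\<And>x :: ('v, 'a fls) mpoly. (1 + x) ^ P = 1 + x ^ P"
proof (cases "CHAR('a) = 0")
  case True
  show thesis
    by (rule that[of 1 e]) (use e True in \<open>auto simp: of_nat_eq_0_iff_char_dvd\<close>)
next
  case False
  then have p: "prime CHAR('a)" using prime_CHAR_semidom by auto
  then have "\<not> is_unit CHAR('a)" by (meson not_prime_unit)
  then obtain e' where e': "e = CHAR('a) ^ multiplicity CHAR('a) e * e'" "\<not> CHAR('a) dvd e'"
    using multiplicity_decompose'[of e "CHAR('a)"] e by blast
  have "(1 + x) ^ (CHAR('a) ^ k) = 1 + x ^ (CHAR('a) ^ k)" for x :: "('v, 'a fls) mpoly" and k
    using freshmans_dream'[of "CHAR('a) ^ k" k 1 x] p by (simp add: CHAR_mpoly_fls)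
  then show thesis
    by (intro that[of "CHAR('a) ^ multiplicity CHAR('a) e" e'])
      (use e' False in \<open>auto simp: of_nat_eq_0_iff_char_dvd\<close>)
qed

subsection \<open>Leading terms\<close>

lemma laurent_denominator:
  obtains q where "(f :: 'a::field fls) * fls_X ^ q \<in> range fps_to_fls"
proof
  let ?q = "nat (- fls_subdegree f)"
  have "0 \<le> fls_subdegree (f * fls_X ^ ?q)"
    by (cases "f = 0") (auto simp: fls_X_power_times_conv_shift)
  then show "f * fls_X ^ ?q \<in> range fps_to_fls"
    by (intro range_eqI[of _ _ "fls_regpart (f * fls_X ^ ?q)"]) (simp add: fls_regpart_to_fls_trivial)
qed

lemma perturbed_mult:
  assumes "x = y + e * s" "x' = y' + e * s'"
    "s \<in> integral_mpoly V" "s' \<in> integral_mpoly V" "y \<in> integral_mpoly V" "y' \<in> integral_mpoly V"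
    "e \<in> integral_mpoly V"
  shows "\<exists>t\<in>integral_mpoly V. x * x' = y * y' + e * t"
proof
  show "x * x' = y * y' + e * (y * s' + s * y' + e * s * s')"
    by (simp add: assms(1,2) algebra_simps)
  show "y * s' + s * y' + e * s * s' \<in> integral_mpoly V"
    using assms(3-7) by (intro integral)
qed

lemma perturbed_power:
  assumes "x = y + e * s" "s \<in> integral_mpoly V" "y \<in> integral_mpoly V" "e \<in> integral_mpoly V"
  shows "\<exists>t\<in>integral_mpoly V. x ^ k = y ^ k + e * t"
proof (induction k)
  case 0
  show ?case by (rule bexI[of _ 0]) (auto intro: integral)
next
  case (Suc k)
  then obtain t where "t \<in> integral_mpoly V" "x ^ k = y ^ k + e * t" by blast
  then show ?case
    using perturbed_mult[of x y e s "x ^ k" "y ^ k" t V] assms by (auto intro: integral)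
qed

lemma perturbed_prod:
  assumes "\<And>v. v \<in> A \<Longrightarrow> x v = y v + e * s v" "\<And>v. v \<in> A \<Longrightarrow> s v \<in> integral_mpoly V"
    "\<And>v. v \<in> A \<Longrightarrow> y v \<in> integral_mpoly V" "e \<in> integral_mpoly V"
  shows "\<exists>t\<in>integral_mpoly V. (\<Prod>v\<in>A. x v ^ k v) = (\<Prod>v\<in>A. y v ^ k v) + e * t"
  using assms
proof (induction A rule: infinite_finite_induct)
  case (insert a A)
  then obtain t where t: "t \<in> integral_mpoly V" "(\<Prod>v\<in>A. x v ^ k v) = (\<Prod>v\<in>A. y v ^ k v) + e * t"
    by auto
  obtain u where u: "u \<in> integral_mpoly V" "x a ^ k a = y a ^ k a + e * u"
    using perturbed_power[of "x a" "y a" e "s a" V "k a"] insert by auto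
  show ?case
    using perturbed_mult[OF u(2) t(2) u(1) t(1)] insert by (auto intro!: integral)
qed (auto intro!: bexI[of _ 0] integral)

text \<open>The variables \<open>DVar k\<close> give a monomial the order 2 G
  \<open>\<beta> \<mu>\<close> in \<epsilon>, while the perturbations \<open>\<rho>\<close> matter
  only from relative order G on. Up to that precision only monomials with
  \<open>\<beta> \<mu> = b\<close> contribute, and these share the factor
  \<open>\<delta> ^ e\<close>.\<close>

lemma leading_term:
  fixes F :: "(diag_var, 'a::field) mpoly" and \<tau> :: "diag_var \<Rightarrow> ('v, 'a fls) mpoly"
    and ZK :: "nat set" and AB :: "diag_var set" and E and K :: nat and \<kappa> :: "diag_var \<Rightarrow> nat"
  defines "E \<equiv> mconst fls_X"
    and "\<beta> \<equiv> \<lambda>\<mu>. \<Sum>k\<in>ZK. Poly_Mapping.lookup \<mu> (DVar k) * K ^ k"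
    and "\<gamma> \<equiv> \<lambda>\<mu>. \<Sum>v\<in>AB. Poly_Mapping.lookup \<mu> v * \<kappa> v"
  assumes fin: "finite ZK" "finite AB"
    and vars: "mvars F \<subseteq> DVar ` ZK \<union> AB" "AB \<inter> range DVar = {}"
    and N: "N \<in> ZK"
    and \<tau>D: "\<And>k. \<tau> (DVar k) = E ^ (2 * (G * K ^ k)) * (if k = N then \<delta> else 1)"
    and \<tau>AB: "\<And>v. v \<in> AB \<Longrightarrow> \<tau> v = E ^ \<kappa> v + E ^ G * \<rho> v"
    and int: "\<And>v. v \<in> AB \<Longrightarrow> \<rho> v \<in> integral_mpoly V" "\<delta> \<in> integral_mpoly V"
    and b: "\<And>\<mu>. \<mu> \<in> Poly_Mapping.keys F \<Longrightarrow> b \<le> \<beta> \<mu>"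
    and e: "\<And>\<mu>. \<mu> \<in> Poly_Mapping.keys F \<Longrightarrow> \<beta> \<mu> = b \<Longrightarrow> Poly_Mapping.lookup \<mu> (DVar N) = e"
  shows "\<exists>t\<in>integral_mpoly V. meval (mconst \<circ> fls_const) \<tau> F =
     E ^ (2 * G * b) * (\<delta> ^ e * mconst (\<Sum>\<mu>\<in>{\<mu> \<in> Poly_Mapping.keys F. \<beta> \<mu> = b}.
         fls_const (Poly_Mapping.lookup F \<mu>) * fls_X ^ \<gamma> \<mu>) + E ^ G * t)"
proof -
  let ?h = "\<lambda>\<mu>. mconst (fls_const (Poly_Mapping.lookup F \<mu>)) :: ('v, 'a fls) mpoly"
  let ?L = "\<lambda>\<mu>. if \<beta> \<mu> = b then \<delta> ^ e * (?h \<mu> * E ^ \<gamma> \<mu>) else 0"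
  have E: "E ^ k \<in> integral_mpoly V" for k unfolding E_def by (intro integral)
  have "\<exists>t\<in>integral_mpoly V. ?h \<mu> * mmon \<tau> \<mu> = E ^ (2 * G * b) * (?L \<mu> + E ^ G * t)"
    if \<mu>: "\<mu> \<in> Poly_Mapping.keys F" for \<mu>
  proof -
    let ?l = "Poly_Mapping.lookup \<mu>"
    have "Poly_Mapping.keys \<mu> \<subseteq> DVar ` ZK \<union> AB" using vars(1) \<mu> by (auto simp: mvars_def)
    then have "mmon \<tau> \<mu> = (\<Prod>v\<in>DVar ` ZK \<union> AB. \<tau> v ^ ?l v)"
      using fin by (intro mmon_superset) auto
    also have "\<dots> = (\<Prod>v\<in>DVar ` ZK. \<tau> v ^ ?l v) * (\<Prod>v\<in>AB. \<tau> v ^ ?l v)"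
      using fin vars(2) by (intro prod.union_disjoint) auto
    also have "(\<Prod>v\<in>DVar ` ZK. \<tau> v ^ ?l v) = (\<Prod>k\<in>ZK. \<tau> (DVar k) ^ ?l (DVar k))"
      by (subst prod.reindex) (auto simp: inj_on_def)
    also have "\<dots> = (\<Prod>k\<in>ZK. E ^ (2 * G * (?l (DVar k) * K ^ k))) * (\<Prod>k\<in>ZK. if k = N then \<delta> ^ ?l (DVar k) else 1)"
      unfolding prod.distrib[symmetric]
      by (intro prod.cong refl) (simp add: \<tau>D power_mult_distrib mult_ac flip: power_mult)
    also have "(\<Prod>k\<in>ZK. E ^ (2 * G * (?l (DVar k) * K ^ k))) = E ^ (2 * G * \<beta> \<mu>)"
      by (simp add: \<beta>_def sum_distrib_left flip: power_sum)
    also have "(\<Prod>k\<in>ZK. if k = N then \<delta> ^ ?l (DVar k) else 1) = \<delta> ^ ?l (DVar N)"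
      using fin N by simp
    finally have mm: "mmon \<tau> \<mu> = E ^ (2 * G * \<beta> \<mu>) * \<delta> ^ ?l (DVar N) * (\<Prod>v\<in>AB. \<tau> v ^ ?l v)" .
    obtain t where t: "t \<in> integral_mpoly V" "(\<Prod>v\<in>AB. \<tau> v ^ ?l v) = (\<Prod>v\<in>AB. (E ^ \<kappa> v) ^ ?l v) + E ^ G * t"
      using perturbed_prod[of AB \<tau> "\<lambda>v. E ^ \<kappa> v" "E ^ G" \<rho> V ?l] \<tau>AB int E by blast
    have "(\<Prod>v\<in>AB. (E ^ \<kappa> v) ^ ?l v) = E ^ \<gamma> \<mu>"
      by (simp add: \<gamma>_def mult.commute flip: power_mult power_sum)
    with t have t: "t \<in> integral_mpoly V" "(\<Prod>v\<in>AB. \<tau> v ^ ?l v) = E ^ \<gamma> \<mu> + E ^ G * t" by simp_all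
    have h: "?h \<mu> \<in> integral_mpoly V" by (rule integral_fls_const)
    show ?thesis
    proof (cases "\<beta> \<mu> = b")
      case True
      have "?h \<mu> * mmon \<tau> \<mu> = E ^ (2 * G * b) * (?L \<mu> + E ^ G * (\<delta> ^ e * ?h \<mu> * t))"
        using e[OF \<mu> True] True by (simp add: mm t(2) algebra_simps)
      moreover have "\<delta> ^ e * ?h \<mu> * t \<in> integral_mpoly V" using int t h by (intro integral)
      ultimately show ?thesis by blast
    next
      case False
      then have "b < \<beta> \<mu>" using b[OF \<mu>] by simp
      then obtain j where j: "\<beta> \<mu> = b + Suc j" by (metis less_imp_Suc_add add_Suc_right)
      \<comment> \<open>One unit of \<open>\<beta>\<close> above the minimum already yields 2 G
        powers of \<epsilon>, of which G go into the error factor.\<close>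
      have "2 * G * \<beta> \<mu> = 2 * G * b + G + (G + 2 * G * j)" by (simp add: j algebra_simps)
      then have "E ^ (2 * G * \<beta> \<mu>) = E ^ (2 * G * b) * E ^ G * E ^ (G + 2 * G * j)"
        by (simp only: power_add)
      then have "?h \<mu> * mmon \<tau> \<mu> = E ^ (2 * G * b) *
        (?L \<mu> + E ^ G * (E ^ (G + 2 * G * j) * ?h \<mu> * \<delta> ^ ?l (DVar N) * (E ^ \<gamma> \<mu> + E ^ G * t)))"
        using False by (simp only: mm t(2) if_False add_0_left mult_ac)
      moreover have "E ^ (G + 2 * G * j) * ?h \<mu> * \<delta> ^ ?l (DVar N) * (E ^ \<gamma> \<mu> + E ^ G * t) \<in> integral_mpoly V"
        using int t h E[of 1] by (intro integral) simp_all
      ultimately show ?thesis by blast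
    qed
  qed
  then obtain t where t: "\<And>\<mu>. \<mu> \<in> Poly_Mapping.keys F \<Longrightarrow> t \<mu> \<in> integral_mpoly V"
    "\<And>\<mu>. \<mu> \<in> Poly_Mapping.keys F \<Longrightarrow> ?h \<mu> * mmon \<tau> \<mu> = E ^ (2 * G * b) * (?L \<mu> + E ^ G * t \<mu>)"
    by metis
  have "meval (mconst \<circ> fls_const) \<tau> F = (\<Sum>\<mu>\<in>Poly_Mapping.keys F. E ^ (2 * G * b) * (?L \<mu> + E ^ G * t \<mu>))"
    unfolding meval_def o_def by (intro sum.cong refl t(2))
  also have "\<dots> = E ^ (2 * G * b) * ((\<Sum>\<mu>\<in>Poly_Mapping.keys F. ?L \<mu>) + E ^ G * (\<Sum>\<mu>\<in>Poly_Mapping.keys F. t \<mu>))"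
    by (simp only: sum.distrib flip: sum_distrib_left)
  also have "(\<Sum>\<mu>\<in>Poly_Mapping.keys F. ?L \<mu>)
      = \<delta> ^ e * (\<Sum>\<mu>\<in>{\<mu> \<in> Poly_Mapping.keys F. \<beta> \<mu> = b}. ?h \<mu> * E ^ \<gamma> \<mu>)"
    by (subst sum.inter_filter) (auto simp: sum_distrib_left intro!: sum.cong)
  also have "(\<Sum>\<mu>\<in>{\<mu> \<in> Poly_Mapping.keys F. \<beta> \<mu> = b}. ?h \<mu> * E ^ \<gamma> \<mu>)
      = mconst (\<Sum>\<mu>\<in>{\<mu> \<in> Poly_Mapping.keys F. \<beta> \<mu> = b}. fls_const (Poly_Mapping.lookup F \<mu>) * fls_X ^ \<gamma> \<mu>)"
    by (simp add: E_def mconst_hom.hom_sum mconst_hom.hom_mult mconst_hom.hom_power)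
  finally show ?thesis using t(1) by (blast intro: integral_sum)
qed

text \<open>Division by \<epsilon>^(B + P) c e' isolates \<open>D\<close>. The leading 1 becomes a
  scalar, removed by \<open>\<nu>\<close>, and the term with \<open>t\<close> stays O(\<epsilon>)
  because its factor \<epsilon>^q absorbs the pole of \<open>inverse c\<close>.\<close>

lemma scaled_expansion:
  fixes S :: "('v, 'a::field fls) mpoly" and c :: "'a fls" and e' :: 'a
  defines "E \<equiv> mconst fls_X"
  assumes c: "c \<noteq> 0" "inverse c * fls_X ^ q \<in> range fps_to_fls" and e': "e' \<noteq> 0"
    and int: "t \<in> integral_mpoly V" "u \<in> integral_mpoly V"
    and S: "S = E ^ B * ((1 + mconst (fls_const e') * E ^ P * D + E ^ Suc P * u) * mconst c
        + E ^ (q + Suc P) * t)"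
  obtains \<kappa> \<nu> s where "s \<in> integral_mpoly V" "mconst \<kappa> * S + mconst \<nu> = D + E * s"
proof -
  define z f where "z = (fls_X :: 'a fls)" and "f = fls_const e'"
  have nz: "z \<noteq> 0" "f \<noteq> 0" using e' by (auto simp: z_def f_def)
  define \<kappa> where "\<kappa> = inverse (c * z ^ (B + P) * f)"
  define \<nu> where "\<nu> = - inverse (z ^ P * f)"
  have k1: "\<kappa> * z ^ B * c = inverse (z ^ P * f)"
    using c nz by (simp add: \<kappa>_def field_simps power_add)
  have k2: "\<kappa> * z ^ B * c * f * z ^ P = 1"
    using nz unfolding k1 by (simp add: field_simps)
  have k3: "\<kappa> * z ^ B * c * z ^ Suc P = z * inverse f"
    using nz unfolding k1 by (simp add: field_simps)
  have k4: "\<kappa> * z ^ B * z ^ (q + Suc P) = z * (inverse c * z ^ q * inverse f)"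
    using c nz by (simp add: \<kappa>_def field_simps power_add)
  define s where "s = mconst (inverse f) * u + mconst (inverse c * z ^ q) * mconst (inverse f) * t"
  have "mconst \<kappa> * S = mconst (\<kappa> * z ^ B * c) + mconst (\<kappa> * z ^ B * c * f * z ^ P) * D
     + mconst (\<kappa> * z ^ B * c * z ^ Suc P) * u + mconst (\<kappa> * z ^ B * z ^ (q + Suc P)) * t"
    by (simp only: S E_def z_def[symmetric] f_def[symmetric] mconst_hom.hom_mult mconst_hom.hom_power
        distrib_left distrib_right mult_1_left) (simp only: mult_ac add_ac)
  also have "\<dots> = mconst (inverse (z ^ P * f)) + D + E * s"
    unfolding k2 k3 k4 unfolding k1
    by (simp only: s_def E_def z_def[symmetric] mconst_hom.hom_mult mconst_1 mult_1_left mult_1_right distrib_left mult_ac add_ac)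
  finally have "mconst \<kappa> * S + mconst \<nu> = D + E * s"
    by (simp add: \<nu>_def mconst_hom.hom_uminus)
  moreover have "mconst (inverse f) \<in> integral_mpoly V"
    unfolding f_def using integral_fls_const[of "inverse e'" V] by (simp only: fls_inverse_const)
  then have "s \<in> integral_mpoly V"
    unfolding s_def z_def using int integral_mconst[OF c(2)] by (intro integral)
  ultimately show thesis using that by blast
qed

section \<open>The affine substitution that exposes a power of the determinant\<close>

context refutation
begin

lemma affine_substitution:
  assumes m: "Suc m ^ 3 \<le> r" and rn: "r \<le> n"
  defines "V \<equiv> {..<m} \<times> {..<m}"
  obtains x \<kappa> \<nu> P t where
    "\<And>i j. i < n \<Longrightarrow> j < n \<Longrightarrow> x i j \<in> affine_forms V \<inter> integral_mpoly V"
    "CHAR('a) = 0 \<Longrightarrow> P = 1" "CHAR('a) > 0 \<Longrightarrow> \<exists>k. P = CHAR('a) ^ k"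
    "t \<in> integral_mpoly V"
    "mconst \<kappa> * refutation_at (mconst \<circ> fls_const) x C + mconst \<nu> = det (var_mat m Pair) ^ P + mconst fls_X * t"
proof -
  let ?F = diag_poly
  let ?l = Poly_Mapping.lookup
  let ?keys = "Poly_Mapping.keys ?F"
  define E :: "(nat \<times> nat, 'a fls) mpoly" where "E = mconst fls_X"
  have intE: "E ^ k \<in> integral_mpoly V" for k unfolding E_def by (intro integral)
  have intE1: "E \<in> integral_mpoly V" unfolding E_def by (intro integral)
  have fin_vars: "finite (mvars ?F)" by (simp add: mvars_def)
  define ZK where "ZK = DVar -` mvars ?F"
  define AB where "AB = mvars ?F - range DVar"
  have fin: "finite ZK" "finite AB"
    using fin_vars by (auto simp: ZK_def AB_def inj_on_def intro!: finite_vimageI)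
  have vars: "mvars ?F \<subseteq> DVar ` ZK \<union> AB" "AB \<inter> range DVar = {}"
    by (auto simp: ZK_def AB_def)
  \<comment> \<open>\<open>K\<close> separates monomials by their exponents in the
    \<open>DVar\<close>, and \<open>K'\<close> below by those in the remaining variables.\<close>
  obtain K where K: "2 \<le> K"
    "\<And>f g k. f \<in> (\<lambda>\<mu> k. ?l \<mu> (DVar k)) ` ?keys \<Longrightarrow> g \<in> (\<lambda>\<mu> k. ?l \<mu> (DVar k)) ` ?keys \<Longrightarrow>
      (\<Sum>k\<in>ZK. f k * K ^ k) = (\<Sum>k\<in>ZK. g k * K ^ k) \<Longrightarrow> k \<in> ZK \<Longrightarrow> f k = g k"
    by (rule separating_weights[of ZK "\<lambda>k. k" "(\<lambda>\<mu> k. ?l \<mu> (DVar k)) ` ?keys"]) (use fin in auto)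
  obtain K' where K': "2 \<le> K'"
    "\<And>f g v. f \<in> ?l ` ?keys \<Longrightarrow> g \<in> ?l ` ?keys \<Longrightarrow>
      (\<Sum>v\<in>AB. f v * K' ^ to_nat v) = (\<Sum>v\<in>AB. g v * K' ^ to_nat v) \<Longrightarrow> v \<in> AB \<Longrightarrow> f v = g v"
    by (rule separating_weights[of AB to_nat "?l ` ?keys"]) (use fin in auto)
  define wt :: "diag_var \<Rightarrow> nat" where "wt v = K' ^ to_nat v" for v
  define \<beta> where "\<beta> = (\<lambda>\<mu>. \<Sum>k\<in>ZK. ?l \<mu> (DVar k) * K ^ k)"
  define \<gamma> where "\<gamma> = (\<lambda>\<mu>. \<Sum>v\<in>AB. ?l \<mu> v * wt v)"
  have "?keys \<noteq> {}" using diag_poly_nonzero by (metis keys_eq_empty)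
  note min = arg_min_if_finite(1)[OF finite_keys this, of \<beta>] arg_min_least[OF finite_keys this, of _ \<beta>]
  define \<mu>0 where "\<mu>0 = arg_min_on \<beta> ?keys"
  note \<mu>0 = min[folded \<mu>0_def]
  define M where "M = {\<mu> \<in> ?keys. \<beta> \<mu> = \<beta> \<mu>0}"
  \<comment> \<open>Monomials of minimal weight agree in all \<open>DVar\<close> exponents and
    differ only in their \<open>AVar\<close> and \<open>BVar\<close> parts. Hence the exponent
    \<open>e\<close> at the pivot is common to all of them.\<close>
  have same: "?l \<mu> (DVar k) = ?l \<mu>0 (DVar k)" if "\<mu> \<in> M" "k \<in> ZK" for \<mu> k
    using that K(2)[OF imageI imageI, of \<mu> \<mu>0 k] \<mu>0(1) unfolding M_def \<beta>_def by simp

  \<comment> \<open>At least \<open>r\<close> distinct indices occur in \<open>\<mu>0\<close>, so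
    one of them is at least \<open>r - 1\<close>. This leaves room for the branching program up to
    the pivot.\<close>
  have "\<exists>N. N < n \<and> ?l \<mu>0 (DVar N) \<noteq> 0 \<and> r \<le> Suc N"
  proof (rule ccontr)
    assume none: "\<not> ?thesis"
    have "{k. k < n \<and> ?l \<mu>0 (DVar k) \<noteq> 0} \<subseteq> {..<r - 1}"
    proof
      fix k assume "k \<in> {k. k < n \<and> ?l \<mu>0 (DVar k) \<noteq> 0}"
      then have "\<not> r \<le> Suc k" using none by blast
      then show "k \<in> {..<r - 1}" by simp
    qed
    then have "card {k. k < n \<and> ?l \<mu>0 (DVar k) \<noteq> 0} \<le> r - 1"
      using card_mono[OF finite_lessThan] by fastforce
    moreover have "0 < r" using m by (rule less_le_trans[rotated]) (rule zero_less_power, simp)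
    ultimately show False using diag_poly_support[OF \<mu>0(1)] by linarith
  qed
  then obtain N where N: "N < n" "0 < ?l \<mu>0 (DVar N)" "r \<le> Suc N" by auto
  then have NZ: "N \<in> ZK" using \<mu>0(1) by (auto simp: ZK_def mvars_def in_keys_iff)
  define e where "e = ?l \<mu>0 (DVar N)"
  have e0: "0 < e" using N by (simp add: e_def)
  obtain P e' where P: "e = P * e'" "0 < P" "(of_nat e' :: 'a) \<noteq> 0"
    "CHAR('a) = 0 \<Longrightarrow> P = 1" "CHAR('a) > 0 \<Longrightarrow> \<exists>k. P = CHAR('a) ^ k"
    "\<And>x :: (nat \<times> nat, 'a fls) mpoly. (1 + x) ^ P = 1 + x ^ P"
    using frobenius_factor[OF e0] by metis

  \<comment> \<open>The common leading coefficient. It is nonzero since no other member of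
    \<open>M\<close> shares the weight \<open>\<gamma> \<mu>0\<close>, so the coefficient at that
    order is the one of \<open>\<mu>0\<close> alone.\<close>
  define c where "c = (\<Sum>\<mu>\<in>M. fls_const (?l ?F \<mu>) * fls_X ^ \<gamma> \<mu>)"
  have "fls_nth c (int (\<gamma> \<mu>0)) = (\<Sum>\<mu>\<in>M. if \<mu> = \<mu>0 then ?l ?F \<mu> else 0)"
    unfolding c_def fls_nth_sum
  proof (intro sum.cong refl)
    fix \<mu> assume \<mu>: "\<mu> \<in> M"
    have "\<mu> = \<mu>0" if "\<gamma> \<mu> = \<gamma> \<mu>0"
    proof (rule poly_mapping_eqI)
      fix v
      consider "v \<in> AB" | k where "v = DVar k" "k \<in> ZK" | "v \<notin> mvars ?F" using vars by auto
      then show "?l \<mu> v = ?l \<mu>0 v"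
      proof cases
        case 1
        then show ?thesis using K'(2)[OF imageI imageI, of \<mu> \<mu>0 v] \<mu> \<mu>0(1) that
            unfolding M_def \<gamma>_def wt_def by simp
      next
        case 2
        then show ?thesis using same[OF \<mu>] by simp
      next
        case 3
        then show ?thesis using \<mu> \<mu>0(1) by (auto simp: M_def mvars_def in_keys_iff)
      qed
    qed
    then show "fls_nth (fls_const (?l ?F \<mu>) * fls_X ^ \<gamma> \<mu>) (int (\<gamma> \<mu>0)) = (if \<mu> = \<mu>0 then ?l ?F \<mu> else 0)"
      by (auto simp: fls_X_power_nth)
  qed
  also have "\<dots> = ?l ?F \<mu>0" using \<mu>0(1) by (simp add: M_def)
  finally have c0: "c \<noteq> 0" using \<mu>0(1) by (auto simp: in_keys_iff)
  obtain q where q: "inverse c * fls_X ^ q \<in> range fps_to_fls" using laurent_denominator .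
  \<comment> \<open>The precision needed: \<open>q\<close> for the pole of \<open>inverse c\<close>,
    \<open>P\<close> to reach the wanted term, and one more so that the error is
    O(\<epsilon>).\<close>
  define G where "G = q + Suc P"
  define w where "w = (\<lambda>k. G * K ^ k)"
  have w: "w i + G \<le> w j" if "i < j" for i j
  proof -
    have "K ^ i < K ^ j" using K(1) that by (intro power_strict_increasing) auto
    then have "K ^ i + 1 \<le> K ^ j" by simp
    then have "G * (K ^ i + 1) \<le> G * K ^ j" by (rule mult_left_mono) simp
    then show ?thesis by (simp add: w_def algebra_simps)
  qed

  have "Suc m ^ 3 \<le> Suc N" using m N by simp
  from det_abp[OF this, where 'a = 'a, folded V_def]
  obtain p :: "nat \<Rightarrow> (nat \<times> nat, 'a fls) mpoly" and a where pa:
    "(\<forall>j k. a j k \<in> affine_forms V \<inter> integral_mpoly V) \<and>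
     (\<forall>k\<le>N. p k = of_bool (k = 0) + (\<Sum>j<k. a j k * p j)) \<and>
     p N = (- 1) ^ m * det (var_mat m Pair)"
    by (elim exE)
  have a: "a j k \<in> affine_forms V \<inter> integral_mpoly V" for j k using pa by blast
  have p: "p k = of_bool (k = 0) + (\<Sum>j<k. a j k * p j)" if "k \<le> N" for k using pa that by blast
  have pN: "p N = (- 1) ^ m * det (var_mat m Pair)" using pa by blast
  \<comment> \<open>The sign undoes the \<open>(- 1) ^ m\<close> in the output of the program, so
    that the pivot becomes 1 + \<epsilon> det.\<close>
  let ?s = "(- 1) ^ m * fls_X :: 'a fls"
  let ?D = "det (var_mat m Pair) :: (nat \<times> nat, 'a fls) mpoly"
  have s: "?s \<in> range fps_to_fls"
    by (rule range_eqI[of _ _ "(- 1) ^ m * fps_X"]) (simp add: fls_times_fps_to_fls fps_to_fls_power)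
  let ?LUX = "\<lambda>L U X. (\<forall>i j. L i j \<in> integral_mpoly V) \<and> (\<forall>i j. i \<le> j \<longrightarrow> L i j = of_bool (i = j)) \<and>
     (\<forall>i j. U i j \<in> integral_mpoly V) \<and> (\<forall>i j. j \<le> i \<longrightarrow> U i j = of_bool (i = j)) \<and>
     (\<forall>i j. X i j \<in> affine_forms V) \<and>
     (\<forall>i j. i < n \<longrightarrow> j < n \<longrightarrow>
       (\<Sum>k<n. L i k * (if k = N then 1 + mconst ?s * p N else 1) * U k j) = X i j) \<and>
     p N \<in> integral_mpoly V"
  have "\<exists>L U X. ?LUX L U X" by (rule abp_matrix_factorization[OF N(1) a p s])
  then obtain L U X where LUX: "\<forall>i j. L i j \<in> integral_mpoly V" "\<forall>i j. i \<le> j \<longrightarrow> L i j = of_bool (i = j)"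
     "\<forall>i j. U i j \<in> integral_mpoly V" "\<forall>i j. j \<le> i \<longrightarrow> U i j = of_bool (i = j)"
     "\<forall>i j. X i j \<in> affine_forms V"
     "\<forall>i j. i < n \<longrightarrow> j < n \<longrightarrow>
       (\<Sum>k<n. L i k * (if k = N then 1 + mconst ?s * p N else 1) * U k j) = X i j"
     and int_pN: "p N \<in> integral_mpoly V"
    by - (elim exE conjE, rule that)
  note L = LUX(1,2)[rule_format] and U = LUX(3,4)[rule_format]
    and X = LUX(5)[rule_format] and LU = LUX(6)[rule_format]
  have sg: "mconst ?s * p N = E * ?D"
    by (simp add: pN E_def mconst_hom.hom_mult mconst_hom.hom_power mconst_hom.hom_uminus
        power_mult_distrib[symmetric] mult_ac flip: mult.assoc)
  have int_D: "?D \<in> integral_mpoly V"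
  proof -
    have "?D = (- 1) ^ m * p N" by (simp add: pN power_mult_distrib[symmetric] flip: mult.assoc)
    also have "\<dots> \<in> integral_mpoly V" using int_pN by (intro integral)
    finally show ?thesis .
  qed
  define d where "d = (\<lambda>k. if k = N then 1 + E * ?D else 1)"
  have LdU: "(\<Sum>k<n. L i k * d k * U k j) = X i j" if "i < n" "j < n" for i j
    using LU[OF that] unfolding d_def sg .
  let ?RQ = "\<lambda>R Q. (\<forall>i j. R i j \<in> integral_mpoly V) \<and> (\<forall>i j. Q i j \<in> integral_mpoly V) \<and>
     (\<forall>i j. i < n \<longrightarrow> j < n \<longrightarrow>
      (\<Sum>k<n. (of_bool (i = k) + E ^ G * R i k) * (E ^ (2 * w k) * d k) * (of_bool (k = j) + E ^ G * Q k j))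
        = E ^ (w i + w j) * X i j)"
  have "\<exists>R Q. ?RQ R Q" by (rule scaled_factorization[OF L U LdU w, folded E_def])
  then obtain R Q where RQ_all: "\<forall>i j. R i j \<in> integral_mpoly V" "\<forall>i j. Q i j \<in> integral_mpoly V"
     "\<forall>i j. i < n \<longrightarrow> j < n \<longrightarrow>
      (\<Sum>k<n. (of_bool (i = k) + E ^ G * R i k) * (E ^ (2 * w k) * d k) * (of_bool (k = j) + E ^ G * Q k j))
        = E ^ (w i + w j) * X i j"
    by - (elim exE conjE, rule that)
  note R = RQ_all(1)[rule_format] and Q = RQ_all(2)[rule_format] and RQ = RQ_all(3)[rule_format]

  \<comment> \<open>With this choice \<open>\<tau>\<close> sends A to A0 (1 + \<epsilon>^G R) and B
    to (1 + \<epsilon>^G Q) B0, where A0 and B0 are constant matrices with entries \<epsilon>^(wt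
    v).\<close>
  define \<rho> where "\<rho> = (\<lambda>v. case v of
      AVar i j \<Rightarrow> \<Sum>k<n. E ^ wt (AVar i k) * R k j
    | BVar i j \<Rightarrow> \<Sum>k<n. Q i k * E ^ wt (BVar k j)
    | DVar k \<Rightarrow> 0)"
  define \<tau> where "\<tau> = (\<lambda>v. case v of
      DVar k \<Rightarrow> E ^ (2 * w k) * d k
    | _ \<Rightarrow> E ^ wt v + E ^ G * \<rho> v)"
  have int_\<rho>: "\<rho> v \<in> integral_mpoly V" for v
    using R Q intE1 by (cases v) (auto simp: \<rho>_def intro!: integral)
  have int_d: "d k \<in> integral_mpoly V" for k
    using int_D intE1 by (auto simp: d_def intro!: integral)
  have int_\<tau>: "\<tau> v \<in> integral_mpoly V" for v
    using int_\<rho>[of v] int_d intE1 by (cases v) (auto simp: \<tau>_def intro!: integral_add integral_mult integral_power)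
  obtain t where t: "t \<in> integral_mpoly V"
    "meval (mconst \<circ> fls_const) \<tau> ?F = E ^ (2 * G * \<beta> \<mu>0) * ((1 + E * ?D) ^ e * mconst c + E ^ G * t)"
  proof -
    have "\<exists>t\<in>integral_mpoly V. meval (mconst \<circ> fls_const) \<tau> ?F
      = mconst fls_X ^ (2 * G * \<beta> \<mu>0) * ((1 + E * ?D) ^ e *
         mconst (\<Sum>\<mu>\<in>{\<mu> \<in> ?keys. (\<Sum>k\<in>ZK. ?l \<mu> (DVar k) * K ^ k) = \<beta> \<mu>0}.
            fls_const (?l ?F \<mu>) * fls_X ^ (\<Sum>v\<in>AB. ?l \<mu> v * wt v)) + mconst fls_X ^ G * t)"
    proof (rule leading_term[OF fin vars NZ])
      show "\<tau> (DVar k) = mconst fls_X ^ (2 * (G * K ^ k)) * (if k = N then 1 + E * ?D else 1)" for k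
        by (simp add: \<tau>_def w_def d_def E_def)
      show "\<tau> v = mconst fls_X ^ wt v + mconst fls_X ^ G * \<rho> v" if "v \<in> AB" for v
        using that vars(2) by (cases v) (auto simp: \<tau>_def E_def)
      show "1 + E * ?D \<in> integral_mpoly V" using int_d[of N] by (simp add: d_def)
      show "\<beta> \<mu>0 \<le> (\<Sum>k\<in>ZK. ?l \<mu> (DVar k) * K ^ k)" if "\<mu> \<in> ?keys" for \<mu>
        using \<mu>0(2)[OF that] by (simp add: \<beta>_def)
      show "?l \<mu> (DVar N) = e" if "\<mu> \<in> ?keys" "(\<Sum>k\<in>ZK. ?l \<mu> (DVar k) * K ^ k) = \<beta> \<mu>0" for \<mu>
        unfolding e_def by (rule same) (use that NZ in \<open>auto simp: M_def \<beta>_def\<close>)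
    qed (rule int_\<rho>)
    then show thesis using that unfolding c_def M_def \<gamma>_def \<beta>_def E_def by blast
  qed

  define x where "x = (\<lambda>i j. \<Sum>k<n. \<tau> (AVar i k) * \<tau> (DVar k) * \<tau> (BVar k j))"
  have Fx: "meval (mconst \<circ> fls_const) \<tau> ?F = 1 - refutation_at (mconst \<circ> fls_const) x C"
    unfolding x_def
    by (rule meval_diag_poly)
       (intro comm_ring_hom_comp comm_ring_hom_mconst, unfold_locales, auto simp: fls_plus_const)
  have int_x: "x i j \<in> integral_mpoly V" for i j
    unfolding x_def using int_\<tau> by (intro integral)
  \<comment> \<open>Regrouping gives A0 (T X T) B0 with T = diag(\<epsilon>^w): the unipotent
    factors recombine into the affine matrix \<open>X\<close>, and everything around it is
    constant.\<close>
  have aff_x: "x i j \<in> affine_forms V" if "i < n" "j < n" for i j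
  proof -
    have A: "\<tau> (AVar i k) = (\<Sum>a<n. E ^ wt (AVar i a) * (of_bool (a = k) + E ^ G * R a k))" if "k < n" for k
    proof -
      have "(\<Sum>a<n. E ^ wt (AVar i a) * (of_bool (a = k) + E ^ G * R a k))
        = (\<Sum>a<n. if a = k then E ^ wt (AVar i k) else 0) + (\<Sum>a<n. E ^ G * (E ^ wt (AVar i a) * R a k))"
        unfolding sum.distrib[symmetric] by (intro sum.cong refl) (simp add: algebra_simps)
      then show ?thesis using that by (simp add: \<tau>_def \<rho>_def sum_distrib_left)
    qed
    have B: "\<tau> (BVar k j) = (\<Sum>b<n. (of_bool (k = b) + E ^ G * Q k b) * E ^ wt (BVar b j))" if "k < n" for k
    proof -
      have "(\<Sum>b<n. (of_bool (k = b) + E ^ G * Q k b) * E ^ wt (BVar b j))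
        = (\<Sum>b<n. if k = b then E ^ wt (BVar k j) else 0) + (\<Sum>b<n. E ^ G * (Q k b * E ^ wt (BVar b j)))"
        unfolding sum.distrib[symmetric] by (intro sum.cong refl) (simp add: algebra_simps)
      then show ?thesis using that by (simp add: \<tau>_def \<rho>_def sum_distrib_left)
    qed
    let ?T = "\<lambda>a k b. (of_bool (a = k) + E ^ G * R a k) * (E ^ (2 * w k) * d k) * (of_bool (k = b) + E ^ G * Q k b)"
    have "x i j = (\<Sum>k<n. (\<Sum>a<n. E ^ wt (AVar i a) * (of_bool (a = k) + E ^ G * R a k)) * (E ^ (2 * w k) * d k)
        * (\<Sum>b<n. (of_bool (k = b) + E ^ G * Q k b) * E ^ wt (BVar b j)))"
      unfolding x_def by (intro sum.cong refl) (simp add: A B, simp add: \<tau>_def)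
    also have "\<dots> = (\<Sum>k<n. \<Sum>b<n. \<Sum>a<n. E ^ wt (AVar i a) * ?T a k b * E ^ wt (BVar b j))"
      by (simp only: sum_distrib_left sum_distrib_right mult.assoc)
    also have "\<dots> = (\<Sum>b<n. \<Sum>k<n. \<Sum>a<n. E ^ wt (AVar i a) * ?T a k b * E ^ wt (BVar b j))"
      by (rule sum.swap)
    also have "\<dots> = (\<Sum>b<n. \<Sum>a<n. \<Sum>k<n. E ^ wt (AVar i a) * ?T a k b * E ^ wt (BVar b j))"
      by (intro sum.cong refl sum.swap)
    also have "\<dots> = (\<Sum>a<n. \<Sum>b<n. \<Sum>k<n. E ^ wt (AVar i a) * ?T a k b * E ^ wt (BVar b j))"
      by (rule sum.swap)
    also have "\<dots> = (\<Sum>a<n. \<Sum>b<n. E ^ wt (AVar i a) * (\<Sum>k<n. ?T a k b) * E ^ wt (BVar b j))"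
      by (simp only: sum_distrib_left sum_distrib_right)
    also have "\<dots> = (\<Sum>a<n. \<Sum>b<n. mconst (fls_X ^ (wt (AVar i a) + (w a + w b) + wt (BVar b j))) * X a b)"
      by (intro sum.cong refl)
         (simp add: RQ, simp add: E_def mconst_hom.hom_power mconst_hom.hom_mult power_add mult_ac)
    also have "\<dots> \<in> affine_forms V" using X by (intro affine_sum affine_scale)
    finally show ?thesis .
  qed

  \<comment> \<open>Since e = P e', the \<open>e\<close>-th power of the pivot is (1 + y)^e'. The
    square of y is divisible by \<epsilon>^(P + 1) because P > 0.\<close>
  let ?y = "(E * ?D) ^ P"
  have int_y: "?y \<in> integral_mpoly V" using int_D intE1 by (intro integral)
  obtain u where u: "u \<in> integral_mpoly V" "(1 + ?y) ^ e' = 1 + of_nat e' * ?y + ?y\<^sup>2 * u"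
    using integral_binomial[OF int_y] by blast
  have "?y\<^sup>2 * u = E ^ Suc P * (E ^ (P - 1) * (?D ^ P)\<^sup>2 * u)"
  proof -
    have "P + P = Suc P + (P - 1)" using P(2) by simp
    then have "E ^ P * E ^ P = E ^ Suc P * E ^ (P - 1)" by (metis power_add)
    moreover have "?y\<^sup>2 * u = E ^ P * E ^ P * ((?D ^ P)\<^sup>2 * u)"
      by (simp only: power2_eq_square power_mult_distrib mult_ac)
    ultimately show ?thesis by (simp only: mult.assoc)
  qed
  then have "(1 + E * ?D) ^ e = 1 + mconst (fls_const (of_nat e')) * E ^ P * ?D ^ P
      + E ^ Suc P * (E ^ (P - 1) * (?D ^ P)\<^sup>2 * u)"
    unfolding P(1) power_mult P(6) u(2) by (simp only: of_nat_mpoly power_mult_distrib mult.assoc)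
  then have S: "1 - refutation_at (mconst \<circ> fls_const) x C = mconst fls_X ^ (2 * G * \<beta> \<mu>0) *
     ((1 + mconst (fls_const (of_nat e')) * mconst fls_X ^ P * ?D ^ P
      + mconst fls_X ^ Suc P * (E ^ (P - 1) * (?D ^ P)\<^sup>2 * u)) * mconst c + mconst fls_X ^ (q + Suc P) * t)"
    using t(2) unfolding Fx G_def E_def by simp
  have "E ^ (P - 1) * (?D ^ P)\<^sup>2 * u \<in> integral_mpoly V" using intE1 int_D u(1) by (intro integral)
  from scaled_expansion[OF c0 q P(3) t(1) this S] obtain \<kappa> \<nu> s where
    s: "s \<in> integral_mpoly V"
    "mconst \<kappa> * (1 - refutation_at (mconst \<circ> fls_const) x C) + mconst \<nu> = ?D ^ P + mconst fls_X * s"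
    by blast
  show thesis
  \<comment> \<open>The scalars change because the expansion concerned 1 - C, whereas the claim is
    about C.\<close>
  proof (rule that[of x P s "- \<kappa>" "\<kappa> + \<nu>"])
    show "mconst (- \<kappa>) * refutation_at (mconst \<circ> fls_const) x C + mconst (\<kappa> + \<nu>) = ?D ^ P + mconst fls_X * s"
      using s(2) by (simp add: mconst_hom.hom_uminus mconst_add algebra_simps)
  qed (use int_x aff_x P(4,5) s(1) in auto)
qed

end

subsection \<open>Substitution into formulas\<close>

primrec formula_subst :: "('c \<Rightarrow> 'd) \<Rightarrow> ('v \<Rightarrow> ('w, 'd) formula) \<Rightarrow> ('v, 'c) formula \<Rightarrow> ('w, 'd) formula" where
  "formula_subst h S (FVar v) = S v"
| "formula_subst h S (FConst c) = FConst (h c)"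
| "formula_subst h S (FAdd \<Phi> \<Psi>) = FAdd (formula_subst h S \<Phi>) (formula_subst h S \<Psi>)"
| "formula_subst h S (FMul \<Phi> \<Psi>) = FMul (formula_subst h S \<Phi>) (formula_subst h S \<Psi>)"

lemma formula_poly_subst:
  assumes "comm_ring_hom h"
  shows "formula_poly (formula_subst h S \<Phi>) = meval (mconst \<circ> h) (\<lambda>v. formula_poly (S v)) (formula_poly \<Phi>)"
proof -
  have "comm_ring_hom (mconst \<circ> h :: _ \<Rightarrow> ('c, 'b) mpoly)"
    by (rule comm_ring_hom_comp[OF assms comm_ring_hom_mconst])
  then have h: "comm_ring_hom (\<lambda>c. mconst (h c) :: ('c, 'b) mpoly)" unfolding o_def .
  show ?thesis
    unfolding o_def
    by (induction \<Phi>) (simp_all add: meval_mvar[OF h] meval_mconst[OF h] meval_add[OF h] meval_mult[OF h])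
qed

lemma formula_vars_subst: "formula_vars (formula_subst h S \<Phi>) = (\<Union>v\<in>formula_vars \<Phi>. formula_vars (S v))"
  by (induction \<Phi>) auto

lemma formula_size_subst:
  assumes "\<And>v. v \<in> formula_vars \<Phi> \<Longrightarrow> formula_size (S v) \<le> B" "1 \<le> B"
  shows "formula_size (formula_subst h S \<Phi>) \<le> B * formula_size \<Phi>"
  using assms(1)
proof (induction \<Phi>)
  case (FAdd \<Phi> \<Psi>)
  then have "formula_size (formula_subst h S \<Phi>) + formula_size (formula_subst h S \<Psi>) + 1
      \<le> B * formula_size \<Phi> + B * formula_size \<Psi> + B"
    using assms(2) by (intro add_mono) auto
  then show ?case by (simp add: distrib_left)
next
  case (FMul \<Phi> \<Psi>)
  then have "formula_size (formula_subst h S \<Phi>) + formula_size (formula_subst h S \<Psi>) + 1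
      \<le> B * formula_size \<Phi> + B * formula_size \<Psi> + B"
    using assms(2) by (intro add_mono) auto
  then show ?case by (simp add: distrib_left)
qed (use assms(2) in auto)

lemma formula_size_pos: "1 \<le> formula_size \<Phi>"
  by (induction \<Phi>) auto

lemma comm_ring_hom_fls_const: "comm_ring_hom (fls_const :: 'a::field \<Rightarrow> 'a fls)"
  by unfold_locales (auto simp: fls_plus_const)

lemma comm_ring_hom_compose_power:
  "0 < N \<Longrightarrow> comm_ring_hom (\<lambda>f :: 'a::field fls. fls_compose_power f N)"
  by unfold_locales auto

lemma map_eq_meval:
  assumes "f 0 = (0 :: 'c::comm_ring_1)"
  shows "Poly_Mapping.map f p = meval (mconst \<circ> f) mvar p"
proof -
  have "q = meval mconst mvar q" for q :: "('v, 'c) mpoly"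
    by (rule poly_mapping_eqI) (use lookup_meval_kill[of _ UNIV q] in simp)
  then have "Poly_Mapping.map f p = meval mconst mvar (Poly_Mapping.map f p)" .
  also have "\<dots> = meval (mconst \<circ> f) mvar p"
    unfolding meval_map[where f = f, OF comm_ring_hom_mconst assms] by (simp add: meval_def)
  finally show ?thesis .
qed

text \<open>The two sides take the determinant over different coefficient rings; the coefficient
  embedding is a ring homomorphism fixing the variables, so it commutes with both the determinant
  and the power.\<close>

lemma map_fls_const_det:
  "Poly_Mapping.map fls_const (det (var_mat m v) ^ P :: ('v, 'a::field) mpoly) = det (var_mat m v) ^ P"
proof -
  have h: "comm_ring_hom (mconst \<circ> fls_const :: 'a \<Rightarrow> ('v, 'a fls) mpoly)"
    by (rule comm_ring_hom_comp[OF comm_ring_hom_fls_const comm_ring_hom_mconst])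
  interpret H: comm_ring_hom "meval (mconst \<circ> fls_const) mvar :: ('v, 'a) mpoly \<Rightarrow> ('v, 'a fls) mpoly"
    by (rule comm_ring_hom_meval[OF h])
  have "map_mat (meval (mconst \<circ> fls_const) mvar) (var_mat m v :: ('v, 'a) mpoly mat) = var_mat m v"
    unfolding mat_meval_var_mat[OF h] by (simp only: var_mat_def)
  then have "meval (mconst \<circ> fls_const) mvar (det (var_mat m v) :: ('v, 'a) mpoly) = det (var_mat m v)"
    by (metis H.hom_det)
  then show ?thesis by (subst map_eq_meval) (simp_all add: H.hom_power)
qed

text \<open>Replacing \<open>\<epsilon>\<close> by \<open>\<epsilon>\<^sup>N\<close> pushes the error term to order \<open>N\<close> without changing the constants of
  the base field.\<close>

lemma border_computes_subst:
  fixes C :: "('v, 'a::field) mpoly"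
  assumes \<Phi>: "border_computes Vs \<Phi> C" and N: "0 < N"
    and C: "mvars C \<subseteq> Vs"
    and S: "\<And>v. v \<in> Vs \<Longrightarrow> formula_poly (S v) = \<sigma> v \<and> \<sigma> v \<in> integral_mpoly V"
  shows "\<exists>t\<in>integral_mpoly V. formula_poly (formula_subst (\<lambda>f. fls_compose_power f N) S \<Phi>)
     = meval (mconst \<circ> fls_const) \<sigma> C + mconst fls_X ^ N * t"
proof -
  let ?c = "\<lambda>f :: 'a fls. fls_compose_power f N"
  let ?p = "\<lambda>v. formula_poly (S v)"
  obtain g :: "('v, 'a fps) mpoly" where g: "mvars g \<subseteq> Vs"
    "formula_poly \<Phi> = Poly_Mapping.map fls_const C + mconst fls_X * Poly_Mapping.map fps_to_fls g"
    using \<Phi> by (auto simp: border_computes_def)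
  define t where "t = meval (mconst \<circ> ?c) ?p (Poly_Mapping.map fps_to_fls g)"
  have h: "comm_ring_hom (mconst \<circ> ?c :: _ \<Rightarrow> ('b, 'a fls) mpoly)"
    by (rule comm_ring_hom_comp[OF comm_ring_hom_compose_power[OF N] comm_ring_hom_mconst])
  have X: "?c fls_X = fls_X ^ N" using N by (simp add: fls_X_power_conv_shift_1)
  have "meval (mconst \<circ> ?c) ?p (Poly_Mapping.map fls_const C) = meval (mconst \<circ> fls_const) ?p C"
    using N by (subst meval_map[OF h]) (simp_all add: meval_def)
  also have "\<dots> = meval (mconst \<circ> fls_const) \<sigma> C"
    using S C by (intro meval_cong) blast
  finally have C': "meval (mconst \<circ> ?c) ?p (Poly_Mapping.map fls_const C) = meval (mconst \<circ> fls_const) \<sigma> C" .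
  have X': "(mconst \<circ> ?c) fls_X = (mconst fls_X ^ N :: ('b, 'a fls) mpoly)"
    by (simp add: X mconst_hom.hom_power)
  have "formula_poly (formula_subst ?c S \<Phi>) = meval (mconst \<circ> fls_const) \<sigma> C + mconst fls_X ^ N * t"
    unfolding formula_poly_subst[OF comm_ring_hom_compose_power[OF N]] g(2) meval_add[OF h]
      meval_mult[OF h] meval_mconst[OF h] t_def C' X' ..
  moreover have "t \<in> integral_mpoly V"
  proof -
    have "t = (\<Sum>m\<in>Poly_Mapping.keys g. mconst (?c (fps_to_fls (Poly_Mapping.lookup g m))) * mmon ?p m)"
      unfolding t_def by (subst meval_map[OF h]) simp_all
    also have "\<dots> \<in> integral_mpoly V"
    proof (intro integral_sum integral_mult integral_mmon)
      fix m assume m: "m \<in> Poly_Mapping.keys g"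
      show "mconst (?c (fps_to_fls (Poly_Mapping.lookup g m))) \<in> integral_mpoly V"
        using N by (intro integral_mconst) (simp add: fls_compose_power_fps_to_fls)
      show "?p v \<in> integral_mpoly V" if "v \<in> Poly_Mapping.keys m" for v
        using that m g(1) S[of v] by (force simp: mvars_def)
    qed
    finally show ?thesis .
  qed
  ultimately show ?thesis by blast
qed

text \<open>Leaves of \<open>\<Phi>\<close> are replaced by formulas for the coordinates of the
  point. The costliest is \<open>UVar\<close>, with three copies of an affine formula of size at
  most 1 + 4 m^2 and four further nodes, hence 7 + 12 m^2. Applying \<open>\<kappa>\<close> and
  \<open>\<nu>\<close> adds four nodes, at most \<open>4 * formula_size \<Phi>\<close>.\<close>

lemma (in refutation) border_formula_for_det:
  fixes \<Phi> :: "(base_var + 'a placeholder, 'a fls) formula"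
  assumes m: "Suc m ^ 3 \<le> r" and rn: "r \<le> n"
    and \<Phi>: "border_computes (Inl ` base_vars n \<union> Inr ` placeholders n \<E>) \<Phi> C"
  shows "\<exists>P (\<Psi> :: (nat \<times> nat, 'a fls) formula). (CHAR('a) = 0 \<longrightarrow> P = 1) \<and> (CHAR('a) > 0 \<longrightarrow> (\<exists>k. P = CHAR('a) ^ k)) \<and>
     border_computes ({..<m} \<times> {..<m}) \<Psi> (det (var_mat m Pair) ^ P) \<and>
     formula_size \<Psi> \<le> (11 + 12 * m\<^sup>2) * formula_size \<Phi>"
proof -
  let ?V = "{..<m} \<times> {..<m}"
  let ?Vs = "Inl ` base_vars n \<union> Inr ` placeholders n \<E>"
  obtain x \<kappa> \<nu> P t where
    x: "\<And>i j. i < n \<Longrightarrow> j < n \<Longrightarrow> x i j \<in> affine_forms ?V \<inter> integral_mpoly ?V"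
    and P: "CHAR('a) = 0 \<Longrightarrow> P = 1" "CHAR('a) > 0 \<Longrightarrow> \<exists>k. P = CHAR('a) ^ k"
    and t: "t \<in> integral_mpoly ?V"
    "mconst \<kappa> * refutation_at (mconst \<circ> fls_const) x C + mconst \<nu> = det (var_mat m Pair) ^ P + mconst fls_X * t"
    using affine_substitution[OF m rn] by metis
  define f where "f = (\<lambda>i j. SOME \<Psi>. formula_poly \<Psi> = x i j \<and> formula_vars \<Psi> \<subseteq> ?V \<and> formula_size \<Psi> \<le> 1 + 4 * m\<^sup>2)"
  have f: "formula_poly (f i j) = x i j \<and> formula_vars (f i j) \<subseteq> ?V \<and> formula_size (f i j) \<le> 1 + 4 * m\<^sup>2"
    if "i < n" "j < n" for i j
    unfolding f_def
    by (rule someI_ex) (use affine_formula[of ?V "x i j"] x[OF that] in \<open>auto simp: power2_eq_square\<close>)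
  define S where "S = case_sum
      (\<lambda>b. case b of XVar i j \<Rightarrow> f i j | YVar i j \<Rightarrow> FConst (of_bool (i = j)))
      (\<lambda>p :: 'a placeholder. case p of
          WVar i j \<Rightarrow> FAdd (f i j) (FConst (- of_bool (i = j)))
        | UVar i j \<Rightarrow> FAdd (FMul (f i j) (f i j)) (FMul (FConst (- 1)) (f i j))
        | _ \<Rightarrow> FConst 0)"
  let ?\<sigma> = "case_sum (base_point x) (placeholder_point x) :: base_var + 'a placeholder \<Rightarrow> _"
  have cases: "Q v" if "v \<in> ?Vs" "\<And>i j. i < n \<Longrightarrow> j < n \<Longrightarrow> Q (Inl (XVar i j))"
    "\<And>i j. i < n \<Longrightarrow> j < n \<Longrightarrow> Q (Inl (YVar i j))" "\<And>E. Q (Inr (ZVar E))"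
    "\<And>i j. i < n \<Longrightarrow> j < n \<Longrightarrow> Q (Inr (WVar i j))" "\<And>i j. i < n \<Longrightarrow> j < n \<Longrightarrow> Q (Inr (UVar i j))"
    "\<And>i j. i < n \<Longrightarrow> j < n \<Longrightarrow> Q (Inr (VVar i j))" for Q :: "base_var + 'a placeholder \<Rightarrow> bool" and v
    using that by (auto simp: base_vars_def placeholders_def)
  have S: "formula_poly (S v) = ?\<sigma> v \<and> ?\<sigma> v \<in> integral_mpoly ?V" if "v \<in> ?Vs" for v
    using that
    by (rule cases)
       (use x f in \<open>auto simp: S_def mconst_hom.hom_uminus of_bool_def intro!: integral\<close>)
  have S_size: "formula_vars (S v) \<subseteq> ?V \<and> formula_size (S v) \<le> 7 + 12 * m\<^sup>2" if "v \<in> ?Vs" for v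
    using that
  proof (rule cases)
    fix i j assume "i < n" "j < n"
    note f = f[OF this]
    show "formula_vars (S (Inl (XVar i j))) \<subseteq> ?V \<and> formula_size (S (Inl (XVar i j))) \<le> 7 + 12 * m\<^sup>2"
      "formula_vars (S (Inr (WVar i j))) \<subseteq> ?V \<and> formula_size (S (Inr (WVar i j))) \<le> 7 + 12 * m\<^sup>2"
      "formula_vars (S (Inr (UVar i j))) \<subseteq> ?V \<and> formula_size (S (Inr (UVar i j))) \<le> 7 + 12 * m\<^sup>2"
      using f by (auto simp: S_def)
  qed (simp_all add: S_def)
  \<comment> \<open>Multiplication by \<open>\<kappa>\<close> may introduce a pole, so the error of
    the given formula is first pushed to order \<open>Suc q\<close>.\<close>
  obtain q where q: "\<kappa> * fls_X ^ q \<in> range fps_to_fls" using laurent_denominator .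
  define \<Phi>' where "\<Phi>' = formula_subst (\<lambda>f. fls_compose_power f (Suc q)) S \<Phi>"
  obtain s where s: "s \<in> integral_mpoly ?V"
    "formula_poly \<Phi>' = refutation_at (mconst \<circ> fls_const) x C + mconst fls_X ^ Suc q * s"
    using border_computes_subst[OF \<Phi> zero_less_Suc mvars_subset, of S ?\<sigma> ?V q] S
    unfolding \<Phi>'_def refutation_at_def by blast
  define \<Psi> where "\<Psi> = FAdd (FMul (FConst \<kappa>) \<Phi>') (FConst \<nu>)"
  have vars: "formula_vars \<Phi> \<subseteq> ?Vs" using \<Phi> by (simp add: border_computes_def)
  have "formula_poly \<Psi> = (mconst \<kappa> * refutation_at (mconst \<circ> fls_const) x C + mconst \<nu>)
      + mconst \<kappa> * mconst fls_X ^ Suc q * s"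
    by (simp add: \<Psi>_def s(2) algebra_simps)
  also have "mconst \<kappa> * mconst fls_X ^ Suc q = mconst fls_X * (mconst (\<kappa> * fls_X ^ q) :: (nat \<times> nat, 'a fls) mpoly)"
    by (simp only: mconst_hom.hom_mult mconst_hom.hom_power power_Suc mult_ac)
  finally have "formula_poly \<Psi> = det (var_mat m Pair) ^ P + mconst fls_X * (t + mconst (\<kappa> * fls_X ^ q) * s)"
    by (simp only: t(2) distrib_left mult.assoc add.assoc)
  moreover have "t + mconst (\<kappa> * fls_X ^ q) * s \<in> integral_mpoly ?V"
    using t(1) s(1) integral_mconst[OF q] by (intro integral)
  then obtain g where "mvars g \<subseteq> ?V" "t + mconst (\<kappa> * fls_X ^ q) * s = Poly_Mapping.map fps_to_fls g"
    by (rule integral_mpolyE)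
  moreover have "formula_vars \<Psi> \<subseteq> ?V"
    unfolding \<Psi>_def \<Phi>'_def using S_size vars by (simp add: formula_vars_subst) blast
  ultimately have "border_computes ?V \<Psi> (det (var_mat m Pair) ^ P)"
    unfolding border_computes_def map_fls_const_det by auto
  moreover have "formula_size \<Psi> \<le> (11 + 12 * m\<^sup>2) * formula_size \<Phi>"
  proof -
    have "formula_size \<Phi>' \<le> (7 + 12 * m\<^sup>2) * formula_size \<Phi>"
      unfolding \<Phi>'_def using S_size vars by (intro formula_size_subst) auto
    moreover have "(11 + 12 * m\<^sup>2) * formula_size \<Phi> = (7 + 12 * m\<^sup>2) * formula_size \<Phi> + 4 * formula_size \<Phi>"
      by (simp add: algebra_simps)
    ultimately show ?thesis using formula_size_pos[of \<Phi>] by (simp add: \<Psi>_def)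
  qed
  ultimately have "(CHAR('a) = 0 \<longrightarrow> P = 1) \<and> (CHAR('a) > 0 \<longrightarrow> (\<exists>k. P = CHAR('a) ^ k)) \<and>
     border_computes ?V \<Psi> (det (var_mat m Pair) ^ P) \<and>
     formula_size \<Psi> \<le> (11 + 12 * m\<^sup>2) * formula_size \<Phi>"
    using P by (intro conjI impI)
  then show ?thesis by (intro exI)
qed

section \<open>Explicit constants and the final bound\<close>

lemma cube_root_floor:
  assumes "0 < r"
  shows "Suc (nat \<lfloor>root 3 (real r)\<rfloor> - 1) ^ 3 \<le> r"
proof -
  let ?k = "nat \<lfloor>root 3 (real r)\<rfloor>"
  have "1 \<le> root 3 (real r)" using assms by (simp add: real_root_ge_1_iff)
  then have "1 \<le> \<lfloor>root 3 (real r)\<rfloor>" by simp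
  \<comment> \<open>Positivity of \<open>r\<close> keeps the truncated subtraction exact.\<close>
  then have k: "Suc (?k - 1) = ?k" by simp
  have "real ?k \<le> root 3 (real r)" by (simp add: of_nat_nat)
  then have "real ?k ^ 3 \<le> root 3 (real r) ^ 3" by (intro power_mono) auto
  also have "\<dots> = real r" by (intro real_root_pow_pos2) auto
  finally have "?k ^ 3 \<le> r" by (metis of_nat_le_iff of_nat_power)
  then show ?thesis unfolding k .
qed

lemma cube_root_floor_bigomega:
  "(\<lambda>r. real (nat \<lfloor>root 3 (real r)\<rfloor> - 1)) \<in> \<Omega>(\<lambda>r. root 3 (real r))"
proof (rule landau_omega.bigI[of "1/2"])
  show "\<forall>\<^sub>F r in at_top. 1 / 2 * norm (root 3 (real r)) \<le> norm (real (nat \<lfloor>root 3 (real r)\<rfloor> - 1))"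
    \<comment> \<open>From 64 on the root is at least 4. Rounding and subtracting 1 lose at most 2,
      so at least half remains.\<close>
    using eventually_ge_at_top[of "64 :: nat"]
  proof eventually_elim
    case (elim r)
    have "root 3 (4 ^ 3) = (4 :: real)" by (rule real_root_power_cancel) auto
    then have "root 3 64 = (4 :: real)" by simp
    then have "4 \<le> root 3 (real r)"
      using elim real_root_le_mono[of 3 64 "real r"] by simp
    then show ?case by (simp add: of_nat_diff) linarith
  qed
qed simp

text \<open>Both Omegas are unfolded: \<open>g\<close> is the inner one and \<open>c\<close> the
  constant of the outer one. They are chosen before \<open>n\<close>, \<open>r\<close>,
  \<open>t\<close> and the refutation, so the bound is uniform in these.\<close>

theorem theorem8p6:
  shows "\<exists>(g :: nat \<Rightarrow> nat) (c :: real).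
    (\<lambda>r. real (g r)) \<in> \<Omega>(\<lambda>r. root 3 (real r)) \<and> c > 0 \<and>
    (\<forall>(n :: nat) (r :: nat) (\<omega> :: 'a::field) (S :: 'a set) (\<E> :: 'a mat set) (t :: nat \<Rightarrow> nat)
        (C :: (base_var + 'a placeholder, 'a) mpoly).
      r \<le> n \<longrightarrow>
      \<omega> \<noteq> 0 \<longrightarrow> mult_order \<omega> \<ge> enat n \<longrightarrow>
      S \<subseteq> UNIV - {0} \<longrightarrow> card S = 2 * r * (n - r) + 1 \<longrightarrow>
      \<E> = {W_mat r n \<omega> \<alpha> | \<alpha>. \<alpha> \<in> S} \<longrightarrow>
      (CHAR('a) = 0 \<longrightarrow>
        (\<forall>m (\<Psi> :: (nat \<times> nat, 'a fls) formula).
          border_computes ({..<m} \<times> {..<m}) \<Psi> (det (var_mat m Pair)) \<longrightarrow>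
          formula_size \<Psi> \<ge> t m)) \<longrightarrow>
      (CHAR('a) > 0 \<longrightarrow>
        (\<forall>m k (\<Psi> :: (nat \<times> nat, 'a fls) formula).
          border_computes ({..<m} \<times> {..<m}) \<Psi> (det (var_mat m Pair) ^ (CHAR('a) ^ k)) \<longrightarrow>
          formula_size \<Psi> \<ge> t m)) \<longrightarrow>
      ips_refutation (base_vars n) (placeholders n \<E>) (rank_inverse_system n) C \<longrightarrow>
      (\<forall>\<Phi> :: (base_var + 'a placeholder, 'a fls) formula.
        border_computes (Inl ` base_vars n \<union> Inr ` placeholders n \<E>) \<Phi> C \<longrightarrow>
        real (formula_size \<Phi>) \<ge> c * (real (t (g r)) / real n ^ 3)))"
proof (intro exI[of _ "\<lambda>r. nat \<lfloor>root 3 (real r)\<rfloor> - 1"] exI[of _ "1 / 23 :: real"] conjI allI impI)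
  fix n r :: nat and \<omega> :: 'a and S :: "'a set" and \<E> :: "'a mat set" and t :: "nat \<Rightarrow> nat"
    and C :: "(base_var + 'a placeholder, 'a) mpoly" and \<Phi> :: "(base_var + 'a placeholder, 'a fls) formula"
  assume rn: "r \<le> n" and \<E>: "\<E> = {W_mat r n \<omega> \<alpha> | \<alpha>. \<alpha> \<in> S}"
    and t0: "CHAR('a) = 0 \<longrightarrow> (\<forall>m (\<Psi> :: (nat \<times> nat, 'a fls) formula).
          border_computes ({..<m} \<times> {..<m}) \<Psi> (det (var_mat m Pair)) \<longrightarrow> formula_size \<Psi> \<ge> t m)"
    and tp: "CHAR('a) > 0 \<longrightarrow> (\<forall>m k (\<Psi> :: (nat \<times> nat, 'a fls) formula).
          border_computes ({..<m} \<times> {..<m}) \<Psi> (det (var_mat m Pair) ^ (CHAR('a) ^ k)) \<longrightarrow> formula_size \<Psi> \<ge> t m)"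
    and C: "ips_refutation (base_vars n) (placeholders n \<E>) (rank_inverse_system n) C"
    and \<Phi>: "border_computes (Inl ` base_vars n \<union> Inr ` placeholders n \<E>) \<Phi> C"
  let ?m = "nat \<lfloor>root 3 (real r)\<rfloor> - 1"
  have t: "t m \<le> formula_size \<Psi>"
    if \<Psi>: "border_computes ({..<m} \<times> {..<m}) \<Psi> (det (var_mat m Pair) ^ P)"
      and P: "CHAR('a) = 0 \<longrightarrow> P = 1" "CHAR('a) > 0 \<longrightarrow> (\<exists>k. P = CHAR('a) ^ k)"
    for m P and \<Psi> :: "(nat \<times> nat, 'a fls) formula"
  proof (cases "CHAR('a) = 0")
    case True
    then show ?thesis using t0 \<Psi> P by simp
  next
    case False
    then obtain k where "P = CHAR('a) ^ k" using P by auto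
    then show ?thesis using tp \<Psi> False by simp
  qed
  show "1 / 23 * (real (t ?m) / real n ^ 3) \<le> real (formula_size \<Phi>)"
  \<comment> \<open>For \<open>n = 0\<close> division by zero makes the left side 0.\<close>
  proof (cases "n = 0")
    case False
    have "t ?m \<le> 23 * n ^ 3 * formula_size \<Phi>"
    \<comment> \<open>For \<open>r = 0\<close> no program fits and truncation gives
      \<open>?m = 0\<close>. The constant formula 1 computes the empty determinant, which bounds
      \<open>t 0\<close> by 1.\<close>
    proof (cases "r = 0")
      case True
      have "Poly_Mapping.map fps_to_fls 0 = (0 :: (nat \<times> nat, 'a fls) mpoly)"
        by (simp add: Poly_Mapping.map_eq_zero_iff)
      then have "border_computes ({..<0} \<times> {..<0}) (FConst 1 :: (nat \<times> nat, 'a fls) formula) (det (var_mat 0 Pair) ^ 1)"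
        unfolding border_computes_def map_fls_const_det
        by (auto simp: var_mat_def mvars_def intro!: exI[of _ 0])
      then have "t 0 \<le> 1" using t[of 0 "FConst 1" 1] by (metis formula_size.simps(2) power_0)
      also have "1 \<le> 23 * n ^ 3 * formula_size \<Phi>"
        using False formula_size_pos[of \<Phi>] by (simp add: Suc_le_eq)
      finally show ?thesis using True by simp
    next
      case r: False
      interpret refutation n r \<E> C
        by unfold_locales (use \<E> C in \<open>auto simp: W_mat_def\<close>)
      have m: "Suc ?m ^ 3 \<le> r" using cube_root_floor r by simp
      from border_formula_for_det[OF m rn \<Phi>] obtain P and \<Psi> :: "(nat \<times> nat, 'a fls) formula" where
        \<Psi>: "CHAR('a) = 0 \<longrightarrow> P = 1" "CHAR('a) > 0 \<longrightarrow> (\<exists>k. P = CHAR('a) ^ k)"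
          "border_computes ({..<?m} \<times> {..<?m}) \<Psi> (det (var_mat ?m Pair) ^ P)"
          "formula_size \<Psi> \<le> (11 + 12 * ?m\<^sup>2) * formula_size \<Phi>"
        by - (elim exE conjE, rule that)
      \<comment> \<open>The constant is 23 = 11 + 12, as both 1 and \<open>?m\<^sup>2\<close> are at
        most \<open>n ^ 3\<close>.\<close>
      have "11 + 12 * ?m\<^sup>2 \<le> 23 * n ^ 3"
      proof -
        have "?m\<^sup>2 \<le> Suc ?m ^ 2" by (intro power_mono) auto
        also have "\<dots> \<le> Suc ?m ^ 3" by (intro power_increasing) auto
        also have "\<dots> \<le> n" using m rn by simp
        also have "\<dots> \<le> n ^ 3" using False by (intro self_le_power) auto
        finally have "?m\<^sup>2 \<le> n ^ 3" .
        moreover have "1 \<le> n ^ 3" using False by (simp add: Suc_le_eq)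
        ultimately show ?thesis by linarith
      qed
      then have "(11 + 12 * ?m\<^sup>2) * formula_size \<Phi> \<le> 23 * n ^ 3 * formula_size \<Phi>"
        by (rule mult_right_mono) simp
      then show ?thesis using t[OF \<Psi>(3,1,2)] \<Psi>(4) by linarith
    qed
    then have "real (t ?m) \<le> real (23 * n ^ 3 * formula_size \<Phi>)" by (simp only: of_nat_le_iff)
    then show ?thesis using False by (simp add: field_simps)
  qed simp
qed (rule cube_root_floor_bigomega, simp)

end
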